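(* Let $E\subset Z$ be an $N$-dimensional affine subspace of $Z$, let $\Phi:Z\to\mathbb{R}$ be a Borel function, and let $$\mu = \big(e^{-\Phi}\,\mathcal{L}^{2N}\big)\times\big(\mathcal{H}^N\llcorner E\big)$$ on $Z\times Z$. Assume that there exist constants $\beta_0>0$, $c>0$ and $b>0$ such that $$\beta_0\|y-z\|^2+\Phi(y)\ \ge\ c\big(\|y\|^2+\|z\|^2\big)-b\qquad\text{for all } y\in Z,\ z\in E .$$ Then the set $M:=\{\mu_\beta:\ \beta\ge 2\beta_0\}$ of thermalizations of $\mu$ is uniformly bounded and uniformly tight in $\mathcal{M}_b(Z\times Z)$. In particular, $\mu$ is weakly transversal and has a diagonal concentration.
   Context: $Z$ is a finite-dimensional real space of dimension $2N$, equipped with a scalar product and the corresponding norm $\|\cdot\|$, and identified with $\mathbb{R}^{2N}$; $\mathcal{L}^{2N}$ is the Lebesgue measure on $Z$, $\mathcal{H}^N$ is the $N$-dimensional Hausdorff measure, and $\mathcal{H}^N\llcorner E$ is its restriction to $E$. $\mathcal{M}^+(Z\times Z)$ denotes the nonnegative Radon measures on $Z\times Z$, $\mathcal{M}_b(Z\times Z)$ the real-valued Radon measures of finite total variation, and $\mathcal{M}_b^+(Z\times Z)$ the nonnegative ones among the latter. Thermalization: for $\mu\in\mathcal{M}^+(Z\times Z)$ and $\beta>0$, $\mu_\beta:=w_\beta\,\mu$ with $w_\beta(y,z):=B_\beta^{-1}e^{-\beta\|y-z\|^2}$ and $B_\beta:=\int_Z e^{-\beta\|\xi\|^2}\,d\mathcal{L}^{2N}(\xi)$.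 A set $M\subseteq\mathcal{M}_b(Z\times Z)$ is uniformly bounded if there is $C>0$ with $|\nu|(Z\times Z)<C$ for all $\nu\in M$. It is uniformly tight if for every $\epsilon>0$ there is a compact set $K_\epsilon\subset Z\times Z$ with $|\nu|((Z\times Z)\setminus K_\epsilon)<\epsilon$ for all $\nu\in M$. Narrow convergence $\mu_k\rightharpoonup\mu$ in $\mathcal{M}_b(Z\times Z)$ means $\int f\,d\mu_k\to\int f\,d\mu$ for all bounded continuous $f:Z\times Z\to\mathbb{R}$. A measure $\mu_\infty\in\mathcal{M}_b^+(Z\times Z)$ is a diagonal concentration of $\mu\in\mathcal{M}^+(Z\times Z)$ if there is a sequence $\beta_h\to+\infty$ such that $\mu_{\beta_h}\in\mathcal{M}_b^+(Z\times Z)$ for all $h$ and $\mu_{\beta_h}\rightharpoonup\mu_\infty$ narrowly. $\mu$ is weakly transversal if it has a diagonal concentration. *)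

theory Defs
  imports "HOL-Analysis.Analysis"
begin

section \<open>Hausdorff measure of integer dimension\<close>

text \<open>
  The normalisation is the usual one: a set \<open>C\<close> has weight \<open>\<omega>\<^sub>n (diam C / 2)\<^sup>n\<close> with \<open>\<omega>\<^sub>n\<close> the volume of the
  Euclidean unit \<open>n\<close>-ball. The empty set has weight \<open>0\<close> also for \<open>n = 0\<close>, where \<open>0 ^ 0 = 1\<close> would
  otherwise give it weight \<open>1\<close>.
  Covering sets are required to be bounded because \<^const>\<open>diameter\<close> is unspecified on unbounded sets.
\<close>

definition hausdorff_weight :: "nat \<Rightarrow> 'a::metric_space set \<Rightarrow> ennreal" where
  "hausdorff_weight n C =
     (if C = {} then 0 else ennreal (unit_ball_vol (real n) * (diameter C / 2) ^ n))"

definition hausdorff_content :: "nat \<Rightarrow> real \<Rightarrow> 'a::metric_space set \<Rightarrow> ennreal" where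
  "hausdorff_content n \<delta> A =
     (INF C \<in> {C :: nat \<Rightarrow> 'a set. (\<forall>i. bounded (C i) \<and> diameter (C i) \<le> \<delta>) \<and> A \<subseteq> (\<Union>i. C i)}.
        \<Sum>i. hausdorff_weight n (C i))"

definition hausdorff_outer :: "nat \<Rightarrow> 'a::metric_space set \<Rightarrow> ennreal" where
  "hausdorff_outer n A = (SUP \<delta> \<in> {0<..}. hausdorff_content n \<delta> A)"

text \<open>
  \<^const>\<open>measure_of\<close> falls back to the zero measure if the set function is not countably additive;
  \<open>emeasure_hausdorff_measure\<close> below shows that this does not happen here.
\<close>

definition hausdorff_measure :: "nat \<Rightarrow> 'a::metric_space measure" where
  "hausdorff_measure n = measure_of UNIV (sets borel) (hausdorff_outer n)"

lemma sets_hausdorff_measure [simp, measurable_cong]: "sets (hausdorff_measure n) = sets borel"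
  unfolding hausdorff_measure_def
  by (metis sets.sets_measure_of_eq space_borel)

lemma space_hausdorff_measure [simp]: "space (hausdorff_measure n) = UNIV"
  by (metis sets_eq_imp_space_eq sets_hausdorff_measure space_borel)

lemma hausdorff_content_mono: "A \<subseteq> B \<Longrightarrow> hausdorff_content n \<delta> A \<le> hausdorff_content n \<delta> B"
  unfolding hausdorff_content_def by (rule INF_superset_mono) auto

lemma hausdorff_content_antimono: "\<delta> \<le> \<epsilon> \<Longrightarrow> hausdorff_content n \<epsilon> A \<le> hausdorff_content n \<delta> A"
  unfolding hausdorff_content_def by (rule INF_superset_mono) (auto intro: order_trans)

lemma hausdorff_content_le:
  assumes "\<And>i. bounded (C i)" "\<And>i. diameter (C i) \<le> \<delta>" "A \<subseteq> (\<Union>i. C i)"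
  shows "hausdorff_content n \<delta> A \<le> (\<Sum>i. hausdorff_weight n (C i))"
  unfolding hausdorff_content_def using assms by (intro INF_lower) auto

lemma hausdorff_content_close:
  assumes "hausdorff_content n \<delta> A < e"
  obtains C where "\<And>i. bounded (C i)" "\<And>i. diameter (C i) \<le> \<delta>" "A \<subseteq> (\<Union>i. C i)"
    "(\<Sum>i. hausdorff_weight n (C i)) < e"
  using assms unfolding hausdorff_content_def INF_less_iff by auto

lemma hausdorff_content_empty:
  assumes "0 < \<delta>"
  shows "hausdorff_content n \<delta> {} = 0"
proof -
  have "hausdorff_content n \<delta> ({}::'a set) \<le> (\<Sum>i. hausdorff_weight n ({}::'a set))"
    using assms by (intro hausdorff_content_le) auto
  then show ?thesis by (simp add: hausdorff_weight_def)
qed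

lemma hausdorff_content_UN_le:
  fixes A :: "nat \<Rightarrow> 'a::metric_space set"
  shows "hausdorff_content n \<delta> (\<Union>i. A i) \<le> (\<Sum>i. hausdorff_content n \<delta> (A i))"
proof (rule ennreal_le_epsilon)
  fix e :: real assume e: "0 < e" "(\<Sum>i. hausdorff_content n \<delta> (A i)) < top"
  then have *: "hausdorff_content n \<delta> (A i) < hausdorff_content n \<delta> (A i) + e * (1/2)^Suc i" for i
    by (auto simp add: less_top dest!: ennreal_suminf_lessD)
  have "\<exists>C. (\<forall>j. bounded (C j) \<and> diameter (C j) \<le> \<delta>) \<and> A i \<subseteq> (\<Union>j. C j) \<and>
      (\<Sum>j. hausdorff_weight n (C j)) \<le> hausdorff_content n \<delta> (A i) + e * (1/2)^Suc i" for i
    by (rule hausdorff_content_close[OF *[of i]]) (blast intro: less_imp_le)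
  then obtain B where B: "\<And>i j. bounded (B i j)" "\<And>i j. diameter (B i j) \<le> \<delta>"
      "\<And>i. A i \<subseteq> (\<Union>j. B i j)"
      "\<And>i. (\<Sum>j. hausdorff_weight n (B i j)) \<le> hausdorff_content n \<delta> (A i) + e * (1/2)^Suc i"
    by metis
  define C where "C = case_prod B o prod_decode"
  have sub: "(\<Union>i. A i) \<subseteq> (\<Union>i. C i)"
    using B(3) by (auto simp add: C_def subset_eq) (metis prod.case prod_encode_inverse)
  have "hausdorff_content n \<delta> (\<Union>i. A i) \<le> (\<Sum>i. hausdorff_weight n (C i))"
    using B(1,2) sub by (intro hausdorff_content_le) (auto simp: C_def split_beta)
  also have "\<dots> = (\<Sum>i. hausdorff_weight n (case_prod B (prod_decode i)))"
    by (simp add: C_def)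
  also have "\<dots> = (\<Sum>i. \<Sum>j. hausdorff_weight n (B i j))"
    by (rule suminf_ennreal_2dimen[of _ "\<lambda>p. hausdorff_weight n (case_prod B p)"]) simp
  also have "\<dots> \<le> (\<Sum>i. hausdorff_content n \<delta> (A i) + e * (1/2) ^ Suc i)"
    by (intro suminf_le B(4)) auto
  also have "\<dots> = (\<Sum>i. hausdorff_content n \<delta> (A i)) + (\<Sum>i. ennreal e * ennreal ((1/2) ^ Suc i))"
    using e(1) by (subst suminf_add[symmetric])
                  (auto simp del: ennreal_suminf_cmult simp add: ennreal_mult[symmetric])
  also have "\<dots> = (\<Sum>i. hausdorff_content n \<delta> (A i)) + e"
    unfolding ennreal_suminf_cmult
    by (subst suminf_ennreal_eq[OF zero_le_power power_half_series]) auto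
  finally show "hausdorff_content n \<delta> (\<Union>i. A i) \<le> (\<Sum>i. hausdorff_content n \<delta> (A i)) + e" .
qed

lemma hausdorff_outer_empty [simp]: "hausdorff_outer n ({} :: 'a::metric_space set) = 0"
proof -
  have "hausdorff_outer n ({} :: 'a set) \<le> 0"
    unfolding hausdorff_outer_def by (rule SUP_least) (simp add: hausdorff_content_empty)
  then show ?thesis by simp
qed

lemma hausdorff_outer_mono: "A \<subseteq> B \<Longrightarrow> hausdorff_outer n A \<le> hausdorff_outer n B"
  unfolding hausdorff_outer_def by (intro SUP_mono') (auto intro: hausdorff_content_mono)

lemma hausdorff_outer_UN_le:
  fixes A :: "nat \<Rightarrow> 'a::metric_space set"
  shows "hausdorff_outer n (\<Union>i. A i) \<le> (\<Sum>i. hausdorff_outer n (A i))"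
proof -
  have "hausdorff_content n \<delta> (\<Union>i. A i) \<le> (\<Sum>i. hausdorff_outer n (A i))" if "\<delta> > 0" for \<delta>
  proof -
    have "hausdorff_content n \<delta> (\<Union>i. A i) \<le> (\<Sum>i. hausdorff_content n \<delta> (A i))"
      by (rule hausdorff_content_UN_le)
    also have "\<dots> \<le> (\<Sum>i. hausdorff_outer n (A i))"
      unfolding hausdorff_outer_def using that by (intro suminf_le SUP_upper) auto
    finally show ?thesis .
  qed
  then show ?thesis unfolding hausdorff_outer_def by (intro SUP_least) (auto simp: hausdorff_outer_def)
qed

lemma outer_measure_space_hausdorff: "outer_measure_space UNIV (hausdorff_outer n)"
  unfolding outer_measure_space_def positive_def increasing_def countably_subadditive_def
  by (auto intro: hausdorff_outer_mono hausdorff_outer_UN_le)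

lemma hausdorff_outer_Un_le: "hausdorff_outer n (A \<union> B) \<le> hausdorff_outer n A + hausdorff_outer n B"
proof -
  have "hausdorff_outer n (\<Union>i. binaryset A B i) \<le> (\<Sum>i. hausdorff_outer n (binaryset A B i))"
    by (rule hausdorff_outer_UN_le)
  then show ?thesis
    by (simp add: UN_binaryset_eq suminf_binaryset_eq)
qed

lemma hausdorff_outer_metric:
  fixes A B :: "'a::metric_space set"
  assumes d: "d > 0" "\<And>x y. x \<in> A \<Longrightarrow> y \<in> B \<Longrightarrow> d \<le> dist x y"
  shows "hausdorff_outer n A + hausdorff_outer n B \<le> hausdorff_outer n (A \<union> B)"
proof -
  have split: "hausdorff_content n \<delta> A + hausdorff_content n \<delta> B \<le> hausdorff_content n \<delta> (A \<union> B)"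
    if \<delta>: "0 < \<delta>" "\<delta> < d" for \<delta>
    unfolding hausdorff_content_def[of n \<delta> "A \<union> B"]
  proof (rule INF_greatest, clarsimp)
    fix C :: "nat \<Rightarrow> 'a set"
    assume C: "\<forall>i. bounded (C i) \<and> diameter (C i) \<le> \<delta>" "A \<subseteq> (\<Union>i. C i)" "B \<subseteq> (\<Union>i. C i)"
    define CA where "CA i = (if C i \<inter> A = {} then {} else C i)" for i
    define CB where "CB i = (if C i \<inter> B = {} then {} else C i)" for i
    have disj: "C i \<inter> A = {} \<or> C i \<inter> B = {}" for i
    proof (rule ccontr)
      assume "\<not> ?thesis"
      then obtain x y where xy: "x \<in> C i" "x \<in> A" "y \<in> C i" "y \<in> B" by auto
      have "dist x y \<le> diameter (C i)"
        using C(1) xy by (intro diameter_bounded_bound) auto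
      with d(2)[OF xy(2,4)] C(1) \<delta> show False by (meson leD le_less_trans)
    qed
    have "hausdorff_content n \<delta> A \<le> (\<Sum>i. hausdorff_weight n (CA i))"
      using C \<delta> by (intro hausdorff_content_le) (fastforce simp: CA_def)+
    moreover have "hausdorff_content n \<delta> B \<le> (\<Sum>i. hausdorff_weight n (CB i))"
      using C \<delta> by (intro hausdorff_content_le) (fastforce simp: CB_def)+
    ultimately have "hausdorff_content n \<delta> A + hausdorff_content n \<delta> B
        \<le> (\<Sum>i. hausdorff_weight n (CA i)) + (\<Sum>i. hausdorff_weight n (CB i))"
      by (rule add_mono)
    also have "\<dots> = (\<Sum>i. hausdorff_weight n (CA i) + hausdorff_weight n (CB i))"
      by (rule suminf_add) auto
    also have "\<dots> \<le> (\<Sum>i. hausdorff_weight n (C i))"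
      using disj by (intro suminf_le) (auto simp: CA_def CB_def hausdorff_weight_def)
    finally show "hausdorff_content n \<delta> A + hausdorff_content n \<delta> B \<le> (\<Sum>i. hausdorff_weight n (C i))" .
  qed
  have le: "hausdorff_content n \<delta> A + hausdorff_content n \<epsilon> B \<le> hausdorff_outer n (A \<union> B)"
    if "0 < \<delta>" "0 < \<epsilon>" for \<delta> \<epsilon>
  proof -
    define \<eta> where "\<eta> = min (min \<delta> \<epsilon>) (d/2)"
    have \<eta>: "0 < \<eta>" "\<eta> < d" "\<eta> \<le> \<delta>" "\<eta> \<le> \<epsilon>"
      using that d(1) by (auto simp: \<eta>_def)
    have "hausdorff_content n \<delta> A + hausdorff_content n \<epsilon> B
        \<le> hausdorff_content n \<eta> A + hausdorff_content n \<eta> B"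
      using \<eta> by (intro add_mono hausdorff_content_antimono)
    also have "\<dots> \<le> hausdorff_content n \<eta> (A \<union> B)"
      using \<eta> by (intro split)
    also have "\<dots> \<le> hausdorff_outer n (A \<union> B)"
      unfolding hausdorff_outer_def using \<eta> by (intro SUP_upper) auto
    finally show ?thesis .
  qed
  have ne: "{0::real<..} \<noteq> {}" by (auto intro: exI[of _ 1])
  have "hausdorff_content n \<delta> A + hausdorff_outer n B \<le> hausdorff_outer n (A \<union> B)" if "0 < \<delta>" for \<delta>
  proof -
    have "hausdorff_content n \<delta> A + (SUP \<epsilon>\<in>{0<..}. hausdorff_content n \<epsilon> B)
        = (SUP \<epsilon>\<in>{0<..}. hausdorff_content n \<delta> A + hausdorff_content n \<epsilon> B)"
      by (rule ennreal_SUP_add_right[OF ne])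
    also have "\<dots> \<le> hausdorff_outer n (A \<union> B)"
      using that by (intro SUP_least le) auto
    finally show ?thesis by (simp add: hausdorff_outer_def[of n B])
  qed
  then have "(SUP \<delta>\<in>{0<..}. hausdorff_content n \<delta> A + hausdorff_outer n B) \<le> hausdorff_outer n (A \<union> B)"
    by (intro SUP_least) auto
  also have "(SUP \<delta>\<in>{0<..}. hausdorff_content n \<delta> A + hausdorff_outer n B)
      = (SUP \<delta>\<in>{0<..}. hausdorff_content n \<delta> A) + hausdorff_outer n B"
    by (rule ennreal_SUP_add_left[OF ne])
  finally show ?thesis by (simp add: hausdorff_outer_def[of n A])
qed

text \<open>Caratheodory's criterion: closed sets are measurable for a metric outer measure.\<close>

lemma closed_hausdorff_split:
  fixes F A :: "'a::metric_space set"
  assumes F: "closed F"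
  shows "hausdorff_outer n (A \<inter> F) + hausdorff_outer n (A - F) \<le> hausdorff_outer n A"
proof (cases "F = {} \<or> hausdorff_outer n A = \<infinity>")
  case True
  then show ?thesis by auto
next
  case False
  then have Fne: "F \<noteq> {}" and fin: "hausdorff_outer n A < \<infinity>" by (auto simp: less_top)
  define f :: "'a set \<Rightarrow> ennreal" where "f = hausdorff_outer n"
  define t where "t k = inverse (real (Suc k))" for k
  define R where "R k = {x \<in> A. t (Suc k) \<le> infdist x F \<and> infdist x F < t k}" for k
  define D where "D k = {x \<in> A. t k \<le> infdist x F}" for k
  have t_less: "t k < t j" if "j < k" for j k
    using that by (auto simp: t_def)
  have t_le: "t k \<le> t j" if "j \<le> k" for j k
    using that by (auto simp: t_def)
  have infd: "infdist x F - infdist y F \<le> dist x y" for x y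
    using infdist_triangle[of x F y] by simp
  have sum_le: "(\<Sum>k<m. f (R (2*k+p))) \<le> f (\<Union>k<m. R (2*k+p))" for m p
  proof (induction m)
    case 0
    then show ?case by simp
  next
    case (Suc m)
    show ?case
    proof (cases "m = 0")
      case True
      then show ?thesis by (simp add: lessThan_Suc)
    next
      case m: False
      have "f (\<Union>k<m. R (2*k+p)) + f (R (2*m+p)) \<le> f ((\<Union>k<m. R (2*k+p)) \<union> R (2*m+p))"
        unfolding f_def
      proof (rule hausdorff_outer_metric)
        show "0 < t (2*m+p-1) - t (2*m+p)"
          using t_less[of "2*m+p-1" "2*m+p"] m by simp
        fix x y assume x: "x \<in> (\<Union>k<m. R (2*k+p))" and y: "y \<in> R (2*m+p)"
        from x obtain k where k: "k < m" "x \<in> R (2*k+p)" by auto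
        have "t (2*m+p-1) \<le> t (Suc (2*k+p))"
          using k by (intro t_le) auto
        then show "t (2*m+p-1) - t (2*m+p) \<le> dist x y"
          using k(2) y infd[of x y] by (auto simp: R_def)
      qed
      moreover have "(\<Union>k<Suc m. R (2*k+p)) = (\<Union>k<m. R (2*k+p)) \<union> R (2*m+p)"
        by (auto simp: lessThan_Suc)
      moreover have "(\<Sum>k<Suc m. f (R (2*k+p))) = (\<Sum>k<m. f (R (2*k+p))) + f (R (2*m+p))"
        by simp
      moreover note order_trans[OF add_right_mono[OF Suc.IH]]
      ultimately show ?thesis by (simp only:)
    qed
  qed
  have R_sub: "f (\<Union>k<m. R (2*k+p)) \<le> f A" for m p
    unfolding f_def by (rule hausdorff_outer_mono) (auto simp: R_def)
  have dbl: "(\<Sum>k<2*m. f (R k)) = (\<Sum>k<m. f (R (2*k+0))) + (\<Sum>k<m. f (R (2*k+1)))" for m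
    by (induction m) (auto simp: algebra_simps)
  define T where "T = (\<Sum>k. f (R k))"
  have "(\<Sum>k<m. f (R k)) \<le> f A + f A" for m
  proof -
    have "(\<Sum>k<m. f (R k)) \<le> (\<Sum>k<2*m. f (R k))"
      by (intro sum_mono2) auto
    also have "\<dots> \<le> f A + f A"
      unfolding dbl by (intro add_mono order_trans[OF sum_le R_sub])
    finally show ?thesis .
  qed
  then have "T \<le> f A + f A"
    unfolding T_def by (intro suminf_le_const) auto
  with fin have Tfin: "T < top"
    by (metis f_def ennreal_add_less_top infinity_ennreal_def le_less_trans)
  show ?thesis
  proof (rule ennreal_le_epsilon)
    fix e :: real assume e: "0 < e"
    have "\<exists>m. T \<le> (\<Sum>k<m. f (R k)) + e"
    proof (cases "T \<le> e")
      case True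
      then show ?thesis by (intro exI[of _ 0]) auto
    next
      case T: False
      have lt: "T - e < T"
        using e T Tfin by (cases T) (auto simp: ennreal_minus ennreal_less_iff)
      have "(\<lambda>m. \<Sum>k<m. f (R k)) \<longlonglongrightarrow> T"
        unfolding T_def by (rule summable_LIMSEQ) auto
      from order_tendstoD(1)[OF this lt] obtain m where "T - e < (\<Sum>k<m. f (R k))"
        by (auto simp: eventually_sequentially)
      then have "T \<le> (\<Sum>k<m. f (R k)) + e"
        by (metis add.commute ennreal_minus_le_iff less_imp_le ennreal_neq_top)
      then show ?thesis ..
    qed
    then obtain m where m: "T \<le> (\<Sum>k<m. f (R k)) + e" ..
    have Tm: "T = (\<Sum>k. f (R (k + m))) + (\<Sum>k<m. f (R k))"
      unfolding T_def by (rule suminf_offset) auto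
    have "(\<Sum>k<m. f (R k)) \<noteq> top"
    proof
      assume "(\<Sum>k<m. f (R k)) = top"
      then have "T = top" by (subst Tm) simp
      with Tfin show False by simp
    qed
    moreover have "(\<Sum>k<m. f (R k)) + (\<Sum>k. f (R (k + m))) \<le> (\<Sum>k<m. f (R k)) + e"
      using m by (subst add.commute) (simp only: Tm[symmetric])
    ultimately have tail: "(\<Sum>k. f (R (k + m))) \<le> e"
      by (simp only: ennreal_add_left_cancel_le) simp
    have sub: "A - F \<subseteq> D m \<union> (\<Union>k. R (k + m))"
    proof
      fix x assume x: "x \<in> A - F"
      have pos: "0 < infdist x F"
        using x F Fne by (simp add: infdist_pos_not_in_closed)
      show "x \<in> D m \<union> (\<Union>k. R (k + m))"
      proof (cases "t m \<le> infdist x F")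
        case True
        then show ?thesis using x by (auto simp: D_def)
      next
        case lt: False
        obtain N where N: "t N < infdist x F"
          using reals_Archimedean[OF pos] unfolding t_def by auto
        define k where "k = (LEAST k. t k \<le> infdist x F)"
        have k: "t k \<le> infdist x F"
          unfolding k_def by (rule LeastI[of _ N]) (use N in auto)
        have km: "m < k"
          using lt k t_le[of k m] by (meson not_le order_trans)
        then obtain j where j: "k = Suc j" by (cases k) auto
        have "\<not> t j \<le> infdist x F"
          using not_less_Least[of j "\<lambda>k. t k \<le> infdist x F"] j unfolding k_def by auto
        then have "x \<in> R j" using k j x by (auto simp: R_def)
        moreover have "j = (j - m) + m" using km j by auto
        ultimately show ?thesis by (metis UN_I UNIV_I UnI2)
      qed
    qed
    have "f (A - F) \<le> f (D m \<union> (\<Union>k. R (k + m)))"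
      unfolding f_def by (rule hausdorff_outer_mono[OF sub])
    also have "\<dots> \<le> f (D m) + f (\<Union>k. R (k + m))"
      unfolding f_def by (rule hausdorff_outer_Un_le)
    also have "\<dots> \<le> f (D m) + (\<Sum>k. f (R (k + m)))"
      unfolding f_def by (intro add_left_mono hausdorff_outer_UN_le)
    also have "\<dots> \<le> f (D m) + e"
      by (intro add_left_mono tail)
    finally have 1: "f (A - F) \<le> f (D m) + e" .
    have "f (A \<inter> F) + f (D m) \<le> f ((A \<inter> F) \<union> D m)"
      unfolding f_def
    proof (rule hausdorff_outer_metric)
      show "0 < t m" by (simp add: t_def)
      fix x y assume "x \<in> A \<inter> F" "y \<in> D m"
      then show "t m \<le> dist x y"
        using infd[of y x] by (auto simp: D_def dist_commute)
    qed
    also have "\<dots> \<le> f A"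
      unfolding f_def by (rule hausdorff_outer_mono) (auto simp: D_def)
    finally have 2: "f (A \<inter> F) + f (D m) \<le> f A" .
    have "f (A \<inter> F) + f (A - F) \<le> (f (A \<inter> F) + f (D m)) + e"
      using add_left_mono[OF 1, of "f (A \<inter> F)"] by (simp add: add.assoc)
    also have "\<dots> \<le> f A + e"
      by (intro add_right_mono 2)
    finally show "hausdorff_outer n (A \<inter> F) + hausdorff_outer n (A - F) \<le> hausdorff_outer n A + e"
      by (simp add: f_def)
  qed
qed

lemma emeasure_hausdorff_measure:
  fixes A :: "'a::metric_space set"
  assumes "A \<in> sets borel"
  shows "emeasure (hausdorff_measure n) A = hausdorff_outer n A"
proof -
  let ?L = "lambda_system UNIV UNIV (hausdorff_outer n :: 'a set \<Rightarrow> ennreal)"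
  interpret P: sigma_algebra UNIV "UNIV :: 'a set set"
    using sigma_algebra_Pow[of "UNIV :: 'a set"] by simp
  have ms: "measure_space UNIV ?L (hausdorff_outer n)"
    by (rule P.caratheodory_lemma[OF outer_measure_space_hausdorff])
  then interpret L: sigma_algebra UNIV ?L by (simp add: measure_space_def)
  have "F \<in> ?L" if "closed F" for F :: "'a set"
  proof -
    have "hausdorff_outer n (A \<inter> F) + hausdorff_outer n (A - F) = hausdorff_outer n A" for A
    proof (rule antisym[OF closed_hausdorff_split[OF that]])
      have "A = (A \<inter> F) \<union> (A - F)" by auto
      then show "hausdorff_outer n A \<le> hausdorff_outer n (A \<inter> F) + hausdorff_outer n (A - F)"
        by (metis hausdorff_outer_Un_le)
    qed
    then show ?thesis by (simp add: P.lambda_system_eq)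
  qed
  then have sub: "sets borel \<subseteq> ?L"
    unfolding borel_eq_closed by (simp, intro L.sigma_sets_subset) auto
  have "measure_space UNIV (sets borel) (hausdorff_outer n :: 'a set \<Rightarrow> ennreal)"
    using ms sub sets.sigma_algebra_axioms[of "borel :: 'a measure"]
    unfolding measure_space_def positive_def countably_additive_def
    by (auto simp: subset_eq image_subset_iff)
  then show ?thesis
    unfolding hausdorff_measure_def
    using assms by (intro emeasure_measure_of_sigma)
      (auto simp: measure_space_def)
qed


section \<open>Radon measures\<close>

text \<open>
  Nonnegative Radon measures are Borel measures that are finite on compact sets. (On the
  \<open>\<sigma>\<close>-compact metric spaces considered here, regularity is then automatic.)
\<close>

definition radon_measures :: "'a::topological_space measure set" where
  "radon_measures = {\<mu>. sets \<mu> = sets borel \<and> (\<forall>K. compact K \<longrightarrow> emeasure \<mu> K < \<infinity>)}"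

definition finite_radon_measures :: "'a::topological_space measure set" where
  "finite_radon_measures = {\<mu> \<in> radon_measures. emeasure \<mu> (space \<mu>) < \<infinity>}"

text \<open>
  A real-valued measure is a countably additive real set function on the Borel sets; off the Borel
  sets its value is normalised to \<open>0\<close>, so that equality of functions is equality of measures.
  A nonnegative finite measure \<open>\<mu>\<close> is identified with the set function \<open>measure \<mu>\<close>, which has the
  same normalisation.
\<close>

definition total_variation :: "('a::topological_space set \<Rightarrow> real) \<Rightarrow> 'a set \<Rightarrow> ennreal" where
  "total_variation \<nu> A =
     (SUP C \<in> {C :: nat \<Rightarrow> 'a set. range C \<subseteq> sets borel \<and> disjoint_family C \<and> (\<Union>i. C i) = A}.
        \<Sum>i. ennreal \<bar>\<nu> (C i)\<bar>)"

definition real_radon_measures :: "('a::topological_space set \<Rightarrow> real) set" where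
  "real_radon_measures =
     {\<nu>. (\<forall>A. A \<notin> sets borel \<longrightarrow> \<nu> A = 0) \<and>
         (\<forall>C :: nat \<Rightarrow> 'a set. range C \<subseteq> sets borel \<and> disjoint_family C \<longrightarrow>
            (\<lambda>i. \<nu> (C i)) sums \<nu> (\<Union>i. C i)) \<and>
         total_variation \<nu> UNIV < \<infinity>}"

text \<open>The integral against a real-valued measure is defined through its Jordan decomposition
  \<open>\<nu> = (\<bar>\<nu>\<bar> + \<nu>) / 2 - (\<bar>\<nu>\<bar> - \<nu>) / 2\<close>.\<close>

definition positive_variation :: "('a::topological_space set \<Rightarrow> real) \<Rightarrow> 'a measure" where
  "positive_variation \<nu> =
     measure_of UNIV (sets borel) (\<lambda>A. ennreal ((enn2real (total_variation \<nu> A) + \<nu> A) / 2))"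

definition negative_variation :: "('a::topological_space set \<Rightarrow> real) \<Rightarrow> 'a measure" where
  "negative_variation \<nu> =
     measure_of UNIV (sets borel) (\<lambda>A. ennreal ((enn2real (total_variation \<nu> A) - \<nu> A) / 2))"

definition real_measure_integral ::
    "('a::topological_space set \<Rightarrow> real) \<Rightarrow> ('a \<Rightarrow> real) \<Rightarrow> real" where
  "real_measure_integral \<nu> f =
     (\<integral>x. f x \<partial>positive_variation \<nu>) - (\<integral>x. f x \<partial>negative_variation \<nu>)"

definition narrow_convergence ::
    "(nat \<Rightarrow> 'a::topological_space set \<Rightarrow> real) \<Rightarrow> ('a set \<Rightarrow> real) \<Rightarrow> bool" where
  "narrow_convergence \<nu>s \<nu> \<longleftrightarrow>
     (\<forall>f :: 'a \<Rightarrow> real. continuous_on UNIV f \<and> bounded (range f) \<longrightarrow>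
        (\<lambda>k. real_measure_integral (\<nu>s k) f) \<longlonglongrightarrow> real_measure_integral \<nu> f)"

definition uniformly_bounded_measures :: "('a::topological_space set \<Rightarrow> real) set \<Rightarrow> bool" where
  "uniformly_bounded_measures M \<longleftrightarrow>
     (\<exists>C::real. C > 0 \<and> (\<forall>\<nu>\<in>M. total_variation \<nu> UNIV < ennreal C))"

definition uniformly_tight_measures :: "('a::topological_space set \<Rightarrow> real) set \<Rightarrow> bool" where
  "uniformly_tight_measures M \<longleftrightarrow>
     (\<forall>\<epsilon>::real. \<epsilon> > 0 \<longrightarrow>
        (\<exists>K. compact K \<and> (\<forall>\<nu>\<in>M. total_variation \<nu> (UNIV - K) < ennreal \<epsilon>)))"

text \<open>For nonnegative finite measures the notions for real-valued measures are the familiar ones.\<close>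

lemma finite_radon_measureD:
  assumes "\<mu> \<in> finite_radon_measures"
  shows "finite_measure \<mu>" "sets \<mu> = sets borel" "space \<mu> = UNIV"
proof -
  show s: "sets \<mu> = sets borel"
    using assms by (auto simp: finite_radon_measures_def radon_measures_def)
  show "space \<mu> = UNIV"
    using sets_eq_imp_space_eq[OF s] by simp
  show "finite_measure \<mu>"
    using assms by (intro finite_measureI) (auto simp: finite_radon_measures_def)
qed

lemma total_variation_measure:
  assumes \<mu>: "\<mu> \<in> finite_radon_measures" and A: "A \<in> sets borel"
  shows "total_variation (measure \<mu>) A = emeasure \<mu> A"
proof -
  interpret finite_measure \<mu> by (rule finite_radon_measureD[OF \<mu>])
  note s = finite_radon_measureD(2)[OF \<mu>]
  let ?S = "{C :: nat \<Rightarrow> 'a set. range C \<subseteq> sets borel \<and> disjoint_family C \<and> (\<Union>i. C i) = A}"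
  have eq: "(\<Sum>i. ennreal \<bar>measure \<mu> (C i)\<bar>) = emeasure \<mu> A" if "C \<in> ?S" for C
  proof -
    have "(\<Sum>i. ennreal \<bar>measure \<mu> (C i)\<bar>) = (\<Sum>i. emeasure \<mu> (C i))"
      by (simp add: emeasure_eq_measure)
    also have "\<dots> = emeasure \<mu> (\<Union>i. C i)"
      using that s by (intro suminf_emeasure) auto
    finally show ?thesis using that by simp
  qed
  have "(\<lambda>i. if i = 0 then A else {}) \<in> ?S"
    using A by (auto simp: disjoint_family_on_def split: if_splits)
  then have "?S \<noteq> {}" by blast
  then have "(SUP C\<in>?S. emeasure \<mu> A) = emeasure \<mu> A" by (rule cSUP_const)
  moreover have "total_variation (measure \<mu>) A = (SUP C\<in>?S. emeasure \<mu> A)"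
    unfolding total_variation_def by (rule SUP_cong[OF refl eq])
  ultimately show ?thesis by simp
qed

lemma measure_in_real_radon_measures:
  assumes \<mu>: "\<mu> \<in> finite_radon_measures"
  shows "measure \<mu> \<in> real_radon_measures"
proof -
  interpret finite_measure \<mu> by (rule finite_radon_measureD[OF \<mu>])
  note s = finite_radon_measureD(2)[OF \<mu>]
  have "total_variation (measure \<mu>) UNIV < \<infinity>"
    by (subst total_variation_measure[OF \<mu>]) (auto simp: emeasure_eq_measure)
  then show ?thesis
    unfolding real_radon_measures_def
    using s by (auto simp: measure_notin_sets intro!: finite_measure_UNION)
qed

lemma real_measure_integral_measure:
  assumes \<mu>: "\<mu> \<in> finite_radon_measures"
  shows "real_measure_integral (measure \<mu>) f = (\<integral>x. f x \<partial>\<mu>)"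
proof -
  interpret finite_measure \<mu> by (rule finite_radon_measureD[OF \<mu>])
  note s = finite_radon_measureD(2)[OF \<mu>] and sp = finite_radon_measureD(3)[OF \<mu>]
  have sa: "sigma_algebra (UNIV :: 'a set) (sets borel)"
    using sets.sigma_algebra_axioms[of "borel :: 'a measure"] by simp
  have tv: "enn2real (total_variation (measure \<mu>) A) = measure \<mu> A" if "A \<in> sets borel" for A
    by (simp add: total_variation_measure[OF \<mu> that] measure_def)
  have "positive_variation (measure \<mu>) = measure_of (space \<mu>) (sets \<mu>) (emeasure \<mu>)"
    unfolding positive_variation_def s sp
    using sa by (intro measure_of_eq)
      (auto simp: sigma_algebra.sigma_sets_eq tv emeasure_eq_measure)
  then have pos: "positive_variation (measure \<mu>) = \<mu>"
    by (simp add: measure_of_of_measure)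
  have "negative_variation (measure \<mu>) = measure_of UNIV (sets borel) (\<lambda>_. 0)"
    unfolding negative_variation_def
    using sa by (intro measure_of_eq) (auto simp: sigma_algebra.sigma_sets_eq tv)
  also have "\<dots> = null_measure borel"
    by (simp add: null_measure_def)
  finally have neg: "negative_variation (measure \<mu>) = null_measure borel" .
  have "(\<integral>x. f x \<partial>(null_measure borel :: 'a measure)) = 0"
  proof (rule integral_eq_zero_AE)
    have "UNIV \<in> null_sets (null_measure borel :: 'a measure)"
      by (simp add: null_sets_def)
    then show "AE x in (null_measure borel :: 'a measure). f x = 0"
      by (rule AE_I') simp
  qed
  then show ?thesis
    by (simp add: real_measure_integral_def pos neg)
qed


section \<open>Thermalization and diagonal concentration\<close>

definition thermal_weight :: "real \<Rightarrow> 'a::euclidean_space \<Rightarrow> 'a \<Rightarrow> real" where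
  "thermal_weight \<beta> y z =
     inverse (\<integral>\<xi>. exp (- \<beta> * (norm \<xi>)\<^sup>2) \<partial>(lborel :: 'a measure)) * exp (- \<beta> * (norm (y - z))\<^sup>2)"

definition thermalization :: "('a::euclidean_space \<times> 'a) measure \<Rightarrow> real \<Rightarrow> ('a \<times> 'a) measure" where
  "thermalization \<mu> \<beta> = density \<mu> (\<lambda>(y, z). ennreal (thermal_weight \<beta> y z))"

definition diagonal_concentration ::
    "('a::euclidean_space \<times> 'a) measure \<Rightarrow> ('a \<times> 'a) measure \<Rightarrow> bool" where
  "diagonal_concentration \<mu> \<mu>' \<longleftrightarrow>
     \<mu> \<in> radon_measures \<and> \<mu>' \<in> finite_radon_measures \<and>
     (\<exists>\<beta> :: nat \<Rightarrow> real.
        (\<forall>h. \<beta> h > 0) \<and> filterlim \<beta> at_top sequentially \<and>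
        (\<forall>h. thermalization \<mu> (\<beta> h) \<in> finite_radon_measures) \<and>
        narrow_convergence (\<lambda>h. measure (thermalization \<mu> (\<beta> h))) (measure \<mu>'))"

definition weakly_transversal :: "('a::euclidean_space \<times> 'a) measure \<Rightarrow> bool" where
  "weakly_transversal \<mu> \<longleftrightarrow> (\<exists>\<mu>'. diagonal_concentration \<mu> \<mu>')"

end

theory Submission
  imports Defs "HOL-Probability.Helly_Selection"
begin

text \<open>
  For \<open>\<beta> \<ge> 2 \<beta>\<^sub>0\<close> the confinement inequality gives, for \<open>z \<in> E\<close>,
  \<open>exp (- \<Phi> y) exp (- \<beta> \<parallel>y - z\<parallel>\<^sup>2) \<le> exp b exp (- c (\<parallel>y\<parallel>\<^sup>2 + \<parallel>z\<parallel>\<^sup>2)) exp (- (\<beta> / 2) \<parallel>y - z\<parallel>\<^sup>2)\<close>,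
  because half of the thermal exponent is enough to compensate \<open>\<Phi>\<close>. After division by \<open>B\<^sub>\<beta>\<close> the last factor has
  the \<open>\<beta>\<close>-independent integral \<open>\<surd>2\<close> to the power \<open>2 N\<close> in \<open>y\<close> (\<open>nn_integral_half_thermal_weight\<close>), and half of
  the decay in \<open>(y, z)\<close> can be spent on smallness outside a ball of radius \<open>R\<close>. What remains is the integral of
  \<open>exp (- (c / 2) \<parallel>z\<parallel>\<^sup>2)\<close> over \<open>E\<close>. Hence the mass of \<open>\<mu>\<^sub>\<beta>\<close> outside the ball is at most a constant times
  \<open>exp (- (c / 2) R\<^sup>2)\<close> (\<open>emeasure_thermalization_outside_le\<close>), which is uniform boundedness and tightness.

  The integral over \<open>E\<close> is finite because \<open>\<H>\<^sup>N\<close> of \<open>E \<inter> cball 0 R\<close> grows at most like \<open>R\<^sup>N\<close>. This is the elementary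
  half of the comparison between Hausdorff and Lebesgue measure and follows by counting grid cubes
  (\<open>hausdorff_outer_affine_cball_le\<close>). The same bound makes \<open>\<H>\<^sup>N\<close> restricted to \<open>E\<close> \<open>\<sigma>\<close>-finite, so that the product
  measure can be computed by iterated integration.

  A diagonal concentration is obtained as a narrow limit along a subsequence of the tight sequence \<open>\<mu>\<^sub>\<beta>\<close>, \<open>\<beta> = 2 \<beta>\<^sub>0 + n\<close>; it exists by Prokhorov's
  theorem (\<open>tight_finite_measures_narrow_subsequence\<close>). In Euclidean space this theorem reduces to Helly's selection
  theorem on the line: there is a continuous curve \<open>\<phi>\<close> that covers every ball in bounded time, constructed
  from Schoenberg's space-filling curve (\<open>proper_space_filling_curve\<close>), and its first hitting time is a
  Borel section. Measures are lifted to the line along the section, and weak limits are pushed forward along \<open>\<phi>\<close>.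
\<close>

section \<open>A proper space-filling curve\<close>

text \<open>
  The distance of \<open>t\<close> to the nearest even integer. In this closed form continuity and periodicity are
  inherited from the cosine.
\<close>

definition triangle_wave :: "real \<Rightarrow> real" where
  "triangle_wave t = arccos (cos (pi * t)) / pi"

lemma continuous_on_triangle_wave [continuous_intros]:
  fixes f :: "'a::t2_space \<Rightarrow> real"
  shows "continuous_on S f \<Longrightarrow> continuous_on S (\<lambda>x. triangle_wave (f x))"
  unfolding triangle_wave_def
  by (rule continuous_on_divide) (auto intro!: continuous_on_arccos continuous_on_cos continuous_on_mult)

lemma triangle_wave_unit: "0 \<le> t \<Longrightarrow> t \<le> 1 \<Longrightarrow> triangle_wave t = t"
  unfolding triangle_wave_def by (subst arccos_cos) auto

lemma triangle_wave_periodic: "triangle_wave (2 * of_int n + t) = triangle_wave t"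
proof -
  have "pi * (2 * of_int n + t) = pi * t + 2 * pi * of_int n" by (simp add: algebra_simps)
  then show ?thesis unfolding triangle_wave_def by (simp only: cos_add cos_int_2pin sin_int_2pin) simp
qed

text \<open>
  Schoenberg's function: \<open>2\<close>-periodic, equal to \<open>0\<close> on \<open>[0, 1/3]\<close> and to \<open>1\<close> on \<open>[2/3, 1]\<close>. It halves
  the first ternary digit of a number in \<open>[0, 1]\<close> all of whose digits are \<open>0\<close> or \<open>2\<close>.
\<close>

definition schoenberg_bump :: "real \<Rightarrow> real" where
  "schoenberg_bump t = max 0 (min 1 (3 * triangle_wave t - 1))"

lemma schoenberg_bump_bounds: "0 \<le> schoenberg_bump t" "schoenberg_bump t \<le> 1"
  by (auto simp: schoenberg_bump_def)

lemma schoenberg_bump_periodic: "schoenberg_bump (2 * of_int n + t) = schoenberg_bump t"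
  by (simp add: schoenberg_bump_def triangle_wave_periodic)

text \<open>
  The \<open>i\<close>-th coordinate of Schoenberg's curve into the unit cube of dimension \<open>m\<close>. For \<open>t\<close> in the
  Cantor set its binary digits are the halved ternary digits of \<open>t\<close> at the positions congruent to \<open>i\<close> modulo \<open>m\<close>,
  so the \<open>m\<close> coordinates use disjoint sets of digits and can be prescribed independently.
\<close>

definition schoenberg_coord :: "nat \<Rightarrow> nat \<Rightarrow> real \<Rightarrow> real" where
  "schoenberg_coord m i t = (\<Sum>k. schoenberg_bump (3 ^ (m * k + i) * t) * (1 / 2) ^ Suc k)"

lemma continuous_on_schoenberg_coord: "continuous_on UNIV (schoenberg_coord m i)"
proof -
  have "uniform_limit UNIV (\<lambda>n t. \<Sum>k<n. schoenberg_bump (3 ^ (m * k + i) * t) * (1 / 2) ^ Suc k)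
      (schoenberg_coord m i) sequentially"
    unfolding schoenberg_coord_def
  proof (rule Weierstrass_m_test)
    show "summable (\<lambda>k. (1 / 2 :: real) ^ Suc k)"
      using power_half_series sums_summable by blast
    show "norm (schoenberg_bump (3 ^ (m * k + i) * t) * (1 / 2) ^ Suc k) \<le> (1 / 2) ^ Suc k" for k t
      using schoenberg_bump_bounds by (auto simp: abs_mult intro!: mult_left_le_one_le)
  qed
  then show ?thesis
    by (rule uniform_limit_theorem[rotated])
       (auto intro!: always_eventually continuous_intros simp: schoenberg_bump_def)
qed

text \<open>
  The point of the Cantor set whose ternary digits are \<open>2 a\<^sub>0, 2 a\<^sub>1, \<dots>\<close>, for \<open>a\<^sub>k\<close> in \<open>{0, 1}\<close>.
\<close>

definition ternary :: "(nat \<Rightarrow> real) \<Rightarrow> real" where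
  "ternary a = (\<Sum>k. 2 * a k * (1 / 3) ^ Suc k)"

lemma summable_ternary:
  assumes "\<And>k. a k \<in> {0, 1}"
  shows "summable (\<lambda>k. 2 * a k * (1 / 3) ^ Suc k :: real)"
proof (rule summable_comparison_test')
  show "summable (\<lambda>k. 2 * (1 / 3) ^ Suc k :: real)"
    by (intro summable_mult) (simp add: summable_mult)
  show "norm (2 * a k * (1 / 3) ^ Suc k) \<le> 2 * (1 / 3) ^ Suc k" if "0 \<le> k" for k
    using assms[of k] by auto
qed

lemma ternary_bounds:
  assumes "\<And>k. a k \<in> {0, 1}"
  shows "0 \<le> ternary a" "ternary a \<le> 1"
proof -
  have nn: "0 \<le> a k" "a k \<le> 1" for k using assms[of k] by auto
  show "0 \<le> ternary a"
    unfolding ternary_def using nn by (intro suminf_nonneg summable_ternary assms) auto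
  have s: "(\<lambda>k. (2 / 3) * (1 / 3) ^ k :: real) sums ((2 / 3) * (1 / (1 - 1 / 3)))"
    by (intro sums_mult geometric_sums) auto
  have "ternary a \<le> (\<Sum>k. (2 / 3) * (1 / 3) ^ k :: real)"
    unfolding ternary_def using nn s
    by (intro suminf_le summable_ternary assms sums_summable[OF s]) (auto simp: mult_left_le)
  then show "ternary a \<le> 1" using sums_unique[OF s] by simp
qed

lemma ternary_shift:
  assumes "\<And>k. a k \<in> {0, 1}"
  shows "3 * ternary a = 2 * a 0 + ternary (\<lambda>k. a (Suc k))"
proof -
  have "ternary a = (\<Sum>k. 2 * a (Suc k) * (1 / 3) ^ Suc (Suc k)) + 2 * a 0 * (1 / 3) ^ Suc 0"
    unfolding ternary_def by (subst suminf_split_head[OF summable_ternary]) (use assms in auto)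
  also have "(\<Sum>k. 2 * a (Suc k) * (1 / 3) ^ Suc (Suc k)) = (1 / 3) * ternary (\<lambda>k. a (Suc k))"
    unfolding ternary_def
    by (subst suminf_mult[symmetric, OF summable_ternary]) (use assms in \<open>auto simp: mult_ac\<close>)
  finally show ?thesis by simp
qed

text \<open>
  Multiplication by \<open>3\<close> drops the leading digit up to the even integer \<open>2 a\<^sub>0\<close>, which the periodic bump does
  not see; by induction, multiplication by \<open>3\<^sup>j\<close> exposes the \<open>j\<close>-th digit.
\<close>

lemma schoenberg_bump_ternary:
  assumes "\<And>k. a k \<in> {0, 1}"
  shows "schoenberg_bump (3 ^ j * ternary a) = a j"
  using assms
proof (induction j arbitrary: a)
  case 0
  have "3 * ternary a = 2 * a 0 + ternary (\<lambda>k. a (Suc k))"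
    "0 \<le> ternary (\<lambda>k. a (Suc k))" "ternary (\<lambda>k. a (Suc k)) \<le> 1" "0 \<le> ternary a" "ternary a \<le> 1"
    using 0 by (auto intro!: ternary_shift ternary_bounds)
  then show ?case
    using 0[of 0] by (auto simp: schoenberg_bump_def triangle_wave_unit)
next
  case (Suc j)
  define n :: int where "n = 3 ^ j * (if a 0 = 0 then 0 else 1)"
  have n: "3 ^ j * a 0 = of_int n" using Suc.prems[of 0] by (auto simp: n_def)
  have "3 ^ Suc j * ternary a = 3 ^ j * (3 * ternary a)" by simp
  also have "\<dots> = 2 * of_int n + 3 ^ j * ternary (\<lambda>k. a (Suc k))"
    unfolding ternary_shift[OF Suc.prems] n[symmetric] by (simp add: algebra_simps)
  finally show ?case using Suc by (simp add: schoenberg_bump_periodic)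
qed

lemma binary_expansion:
  fixes x :: real
  assumes "0 \<le> x" "x \<le> 1"
  obtains a :: "nat \<Rightarrow> real" where "\<And>k. a k \<in> {0, 1}" "(\<lambda>k. a k * (1 / 2) ^ Suc k) sums x"
proof (cases "x = 1")
  case True
  with power_half_series show thesis by (intro that[of "\<lambda>_. 1"]) auto
next
  case False
  \<comment> \<open>The digit is the difference of consecutive dyadic truncations of \<open>x\<close>, so partial sums telescope. For
    \<open>x = 1\<close> these digits would all be \<open>0\<close>, hence the separate case.\<close>
  define a where "a k = real_of_int (\<lfloor>2 ^ Suc k * x\<rfloor> - 2 * \<lfloor>2 ^ k * x\<rfloor>)" for k
  have "a k \<in> {0, 1}" for k
  proof -
    have "\<lfloor>2 ^ Suc k * x\<rfloor> - 2 * \<lfloor>2 ^ k * x\<rfloor> \<in> {0, 1}"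
      by simp linarith
    then show ?thesis by (auto simp: a_def)
  qed
  moreover have "(\<lambda>k. a k * (1 / 2) ^ Suc k) sums x"
    unfolding sums_def
  proof -
    have *: "(\<Sum>k<n. a k * (1 / 2) ^ Suc k) = of_int \<lfloor>2 ^ n * x\<rfloor> / 2 ^ n" for n
    proof (induction n)
      case 0
      have "\<lfloor>x\<rfloor> = 0" using assms False by linarith
      then show ?case by simp
    next
      case (Suc n)
      then show ?case by (simp add: a_def field_simps)
    qed
    show "(\<lambda>n. \<Sum>k<n. a k * (1 / 2) ^ Suc k) \<longlonglongrightarrow> x"
      unfolding *
    proof (rule tendsto_sandwich[OF always_eventually always_eventually])
      show "\<forall>n. x - (1 / 2) ^ n \<le> of_int \<lfloor>2 ^ n * x\<rfloor> / 2 ^ n"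
      proof
        fix n
        have "2 ^ n * x - 1 \<le> of_int \<lfloor>2 ^ n * x\<rfloor>" by linarith
        then show "x - (1 / 2) ^ n \<le> of_int \<lfloor>2 ^ n * x\<rfloor> / 2 ^ n"
          using divide_right_mono[of "2 ^ n * x - 1" "of_int \<lfloor>2 ^ n * x\<rfloor>" "2 ^ n"]
          by (simp add: diff_divide_distrib power_divide)
      qed
      show "\<forall>n. of_int \<lfloor>2 ^ n * x\<rfloor> / 2 ^ n \<le> x" by (simp add: field_simps)
      have "(\<lambda>n. x - (1 / 2) ^ n) \<longlonglongrightarrow> x - 0"
        by (intro tendsto_intros LIMSEQ_power_zero) auto
      then show "(\<lambda>n. x - (1 / 2) ^ n) \<longlonglongrightarrow> x" by simp
    qed auto
  qed
  ultimately show thesis by (rule that)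
qed

text \<open>
  Interleaving the binary digits of the coordinates gives the ternary digits of a parameter \<open>t\<close>. The
  shift by even integers lets one period of the curve serve on every interval \<open>[2 n, 2 n + 1]\<close>.
\<close>

lemma schoenberg_curve_surj:
  assumes x: "\<And>i. i < m \<Longrightarrow> 0 \<le> x i \<and> x i \<le> 1"
  obtains t where "0 \<le> t" "t \<le> 1" "\<And>i n. i < m \<Longrightarrow> schoenberg_coord m i (2 * of_int n + t) = x i"
proof -
  have "\<exists>a :: nat \<Rightarrow> real. (\<forall>k. a k \<in> {0, 1}) \<and> (\<lambda>k. a k * (1 / 2) ^ Suc k) sums x i" if "i < m" for i
    by (rule binary_expansion[of "x i"]) (use x[OF that] in auto)
  then obtain a :: "nat \<Rightarrow> nat \<Rightarrow> real" where
    a: "\<And>i k. i < m \<Longrightarrow> a i k \<in> {0, 1}" "\<And>i. i < m \<Longrightarrow> (\<lambda>k. a i k * (1 / 2) ^ Suc k) sums x i"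
    by metis
  \<comment> \<open>\<open>d\<close> interleaves the digit sequences; for \<open>m = 0\<close> there is nothing to interleave and the
    digits \<open>a\<close> are arbitrary.\<close>
  define d where "d j = (if m = 0 then 0 else a (j mod m) (j div m))" for j
  have d: "d k \<in> {0, 1}" for k
    using a(1)[of "k mod m" "k div m"] by (auto simp: d_def)
  have "schoenberg_coord m i (2 * of_int n + ternary d) = x i" if "i < m" for i n
  proof -
    have "schoenberg_bump (3 ^ (m * k + i) * (2 * of_int n + ternary d)) = a i k" for k
    proof -
      have "3 ^ (m * k + i) * (2 * of_int n + ternary d) =
          2 * of_int (3 ^ (m * k + i) * n) + 3 ^ (m * k + i) * ternary d"
        by (simp add: algebra_simps)
      also have "schoenberg_bump \<dots> = d (m * k + i)"
        using d by (simp only: schoenberg_bump_periodic schoenberg_bump_ternary)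
      also have "\<dots> = a i k" using that by (simp add: d_def)
      finally show ?thesis .
    qed
    then show ?thesis
      unfolding schoenberg_coord_def using sums_unique[OF a(2)[OF that]] by (simp only:)
  qed
  with ternary_bounds[OF d] show thesis by (rule that)
qed

text \<open>
  The centred Schoenberg curve fills the cube \<open>[-1, 1]\<close> to the power \<open>DIM('a)\<close> during each interval
  \<open>[2 n, 2 n + 1]\<close>; scaling it there by \<open>n\<close> fills a cube around the ball of radius \<open>n\<close>. The explicit time bound
  is what later carries tightness back to the line.
\<close>

lemma proper_space_filling_curve:
  obtains \<phi> :: "real \<Rightarrow> 'a::euclidean_space" where "continuous_on UNIV \<phi>"
    "\<And>n. cball 0 (real n) \<subseteq> \<phi> ` {0..2 * real n + 1}"
proof -
  obtain e :: "'a \<Rightarrow> nat" where "bij_betw e Basis {0..<DIM('a)}"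
    using ex_bij_betw_finite_nat[OF finite_Basis] by blast
  then have e: "e b < DIM('a)" "inj_on e (Basis :: 'a set)" if "b \<in> Basis" for b
    using that by (auto simp: bij_betw_def)
  define ei where "ei = the_inv_into (Basis :: 'a set) e"
  have ei: "ei (e b) = b" if "b \<in> Basis" for b
    using e[OF that] that unfolding ei_def by (simp add: the_inv_into_f_f)
  \<comment> \<open>\<open>\<psi>\<close> is continuous and equals \<open>n\<close> on \<open>[2 n, 2 n + 1]\<close>: there the triangle wave has slope \<open>1\<close>, while on the
    descending halves of its period \<open>\<psi>\<close> climbs from \<open>n\<close> to \<open>n + 1\<close>.\<close>
  define \<psi> where "\<psi> t = (t - triangle_wave t) / 2" for t
  define \<phi> :: "real \<Rightarrow> 'a" where
    "\<phi> t = (\<Sum>b\<in>Basis. (\<psi> t * (2 * schoenberg_coord DIM('a) (e b) t - 1)) *\<^sub>R b)" for t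
  show thesis
  proof
    have [continuous_intros]: "continuous_on UNIV (schoenberg_coord m i)" for m i
      by (rule continuous_on_schoenberg_coord)
    show "continuous_on UNIV \<phi>"
      unfolding \<phi>_def \<psi>_def by (intro continuous_intros) auto
    fix n
    show "cball 0 (real n) \<subseteq> \<phi> ` {0..2 * real n + 1}"
    proof
      fix x :: 'a assume "x \<in> cball 0 (real n)"
      then have xb: "\<bar>x \<bullet> b\<bar> \<le> real n" if "b \<in> Basis" for b
        using Basis_le_norm[OF that, of x] by simp
      \<comment> \<open>For \<open>n = 0\<close> the point is the origin and any parameter will do. The truncation of \<open>u\<close> below is vacuous
        at indices of basis vectors and makes the bounds hold at every index.\<close>
      define u where "u i = (if n = 0 then 0 else (x \<bullet> ei i / n + 1) / 2)" for i
      have ub: "0 \<le> max 0 (min 1 (u i)) \<and> max 0 (min 1 (u i)) \<le> 1" for i by auto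
      obtain t where t: "0 \<le> t" "t \<le> 1" "\<And>i. i < DIM('a) \<Longrightarrow>
          schoenberg_coord DIM('a) i (2 * of_int (int n) + t) = max 0 (min 1 (u i))"
        using schoenberg_curve_surj[of "DIM('a)" "\<lambda>i. max 0 (min 1 (u i))"] ub by metis
      have \<psi>: "\<psi> (2 * of_int (int n) + t) = n"
        unfolding \<psi>_def triangle_wave_periodic using t by (simp add: triangle_wave_unit)
      have "\<phi> (2 * of_int (int n) + t) = (\<Sum>b\<in>Basis. (x \<bullet> b) *\<^sub>R b)"
        unfolding \<phi>_def \<psi>
      proof (rule sum.cong)
        fix b :: 'a assume b: "b \<in> Basis"
        have "real n * (2 * max 0 (min 1 (u (e b))) - 1) = x \<bullet> b"
        proof (cases "n = 0")
          case True
          with xb[OF b] show ?thesis by simp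
        next
          case False
          then have "-1 \<le> x \<bullet> b / n" "x \<bullet> b / n \<le> 1"
            using xb[OF b] by (auto simp: field_simps)
          then have "max 0 (min 1 (u (e b))) = (x \<bullet> b / n + 1) / 2"
            using False by (simp add: u_def ei[OF b])
          with False show ?thesis by (simp only:) (simp add: field_simps)
        qed
        then show "(real n * (2 * schoenberg_coord DIM('a) (e b) (2 * real_of_int (int n) + t) - 1)) *\<^sub>R b
            = (x \<bullet> b) *\<^sub>R b"
          using t(3)[OF e(1)[OF b]] by simp
      qed auto
      also have "\<dots> = x" by (rule euclidean_representation)
      finally have "x = \<phi> (2 * real n + t)" by simp
      then show "x \<in> \<phi> ` {0..2 * real n + 1}"
        using t by auto
    qed
  qed
qed

section \<open>Narrow compactness of tight sequences of measures\<close>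

text \<open>
  The first hitting time \<open>s x\<close> of \<open>x\<close> after time \<open>0\<close> is a section of the curve. It is Borel because its
  sublevel sets are the images \<open>\<phi> ` {0..a}\<close>, which are compact.
\<close>

lemma borel_section_of_proper_curve:
  fixes \<phi> :: "real \<Rightarrow> 'a::euclidean_space"
  assumes cont: "continuous_on UNIV \<phi>" and cover: "\<And>n. cball 0 (real n) \<subseteq> \<phi> ` {0..2 * real n + 1}"
  obtains s where "s \<in> borel_measurable borel" "\<And>x. \<phi> (s x) = x" "\<And>x. 0 \<le> s x"
    "\<And>n x. norm x \<le> real n \<Longrightarrow> s x \<le> 2 * real n + 1"
proof -
  define T where "T x = {t. 0 \<le> t \<and> \<phi> t = x}" for x
  define s where "s x = Inf (T x)" for x
  have bdd: "bdd_below (T x)" for x by (rule bdd_belowI[of _ 0]) (auto simp: T_def)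
  have ne: "T x \<noteq> {}" for x
  proof -
    obtain n where "norm x \<le> real n" using real_arch_simple by blast
    then have "x \<in> \<phi> ` {0..2 * real n + 1}" using cover[of n] by auto
    then show ?thesis by (auto simp: T_def)
  qed
  have "closed (T x)" for x
  proof -
    have "closed ({0..} \<inter> {t. \<phi> t = x})"
      using cont by (intro closed_Int closed_Collect_eq continuous_on_const) auto
    then show ?thesis by (simp add: T_def Collect_conj_eq atLeast_def)
  qed
  then have s: "s x \<in> T x" for x
    unfolding s_def by (intro closed_contains_Inf ne bdd)
  have le: "s x \<le> t" if "0 \<le> t" "\<phi> t = x" for x t
    unfolding s_def using that by (intro cInf_lower bdd) (simp add: T_def)
  have "{x. s x \<le> a} = \<phi> ` {0..a}" for a
  proof
    show "{x. s x \<le> a} \<subseteq> \<phi> ` {0..a}"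
    proof
      fix x assume "x \<in> {x. s x \<le> a}"
      then show "x \<in> \<phi> ` {0..a}" using s[of x] by (intro image_eqI[of _ _ "s x"]) (auto simp: T_def)
    qed
    show "\<phi> ` {0..a} \<subseteq> {x. s x \<le> a}" using le by fastforce
  qed
  moreover have "closed (\<phi> ` {0..a})" for a
    by (intro compact_imp_closed compact_continuous_image continuous_on_subset[OF cont]) auto
  ultimately have "s \<in> borel_measurable borel"
    unfolding borel_measurable_iff_le by auto
  moreover have "s x \<le> 2 * real n + 1" if n: "norm x \<le> real n" for n x
  proof -
    obtain t where "t \<in> {0..2 * real n + 1}" "x = \<phi> t" using cover[of n] n by auto
    then show ?thesis using le[of t x] by auto
  qed
  ultimately show thesis using s that[of s] by (auto simp: T_def)
qed

text \<open>
  The section transports the measures to the line, where they stay tight since balls are hit in bounded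
  time. A weak limit there, pushed forward along \<open>\<phi>\<close>, is a narrow limit of the original sequence: a bounded
  continuous \<open>f\<close> pulls back to the bounded continuous \<open>f \<circ> \<phi>\<close>, and \<open>\<phi> \<circ> s\<close> is the identity.
\<close>

lemma tight_prob_measures_narrow_subsequence:
  fixes P :: "nat \<Rightarrow> 'a::euclidean_space measure"
  assumes prob: "\<And>n. prob_space (P n)" and sets: "\<And>n. sets (P n) = sets borel"
    and tight: "\<And>\<epsilon>::real. \<epsilon> > 0 \<Longrightarrow> \<exists>R. \<forall>n. measure (P n) (cball 0 R) > 1 - \<epsilon>"
  obtains r Q where "strict_mono (r :: nat \<Rightarrow> nat)" "prob_space Q" "sets Q = sets borel"
    "\<And>f :: 'a \<Rightarrow> real. continuous_on UNIV f \<Longrightarrow> bounded (range f) \<Longrightarrow>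
       (\<lambda>n. \<integral>x. f x \<partial>P (r n)) \<longlonglongrightarrow> (\<integral>x. f x \<partial>Q)"
proof -
  obtain \<phi> :: "real \<Rightarrow> 'a" where \<phi>: "continuous_on UNIV \<phi>"
    "\<And>n. cball 0 (real n) \<subseteq> \<phi> ` {0..2 * real n + 1}"
    by (rule proper_space_filling_curve) blast
  obtain s where s: "s \<in> borel_measurable borel" "\<And>x. \<phi> (s x) = x" "\<And>x. 0 \<le> s x"
    "\<And>n x. norm x \<le> real n \<Longrightarrow> s x \<le> 2 * real n + 1"
    using borel_section_of_proper_curve[OF \<phi>] by blast
  have [measurable_cong]: "sets (P n) = sets borel" for n by (rule sets)
  have space: "space (P n) = UNIV" for n using sets_eq_imp_space_eq[OF sets] by simp
  have s_meas [measurable]: "s \<in> borel_measurable (P n)" for n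
    using s(1) measurable_cong_sets[OF sets refl] by blast
  have \<phi>_meas [measurable]: "\<phi> \<in> borel_measurable borel"
    by (rule borel_measurable_continuous_onI[OF \<phi>(1)])
  define L where "L n = distr (P n) borel s" for n
  have L: "real_distribution (L n)" for n
  proof -
    interpret prob_space "P n" by (rule prob)
    show ?thesis unfolding L_def by (rule real_distribution_distr) measurable
  qed
  have "tight L"
    unfolding tight_def
  proof (intro conjI allI impI L)
    fix \<epsilon> :: real assume "\<epsilon> > 0"
    then obtain R where R: "\<And>n. measure (P n) (cball 0 R) > 1 - \<epsilon>" using tight by blast
    obtain k :: nat where k: "R \<le> k" using real_arch_simple by blast
    have "measure (L n) {-1<..2 * real k + 1} > 1 - \<epsilon>" for n
    proof -
      interpret prob_space "P n" by (rule prob)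
      have "measure (P n) (cball 0 R) \<le> measure (P n) (s -` {-1<..2 * real k + 1} \<inter> space (P n))"
      proof (rule finite_measure_mono)
        show "cball 0 R \<subseteq> s -` {-1<..2 * real k + 1} \<inter> space (P n)"
        proof
          fix x :: 'a assume "x \<in> cball 0 R"
          then have "norm x \<le> real k" using k by simp
          then show "x \<in> s -` {-1<..2 * real k + 1} \<inter> space (P n)"
            using s(3)[of x] s(4)[of x k] by (auto simp: space)
        qed
      qed measurable
      also have "\<dots> = measure (L n) {-1<..2 * real k + 1}"
        unfolding L_def by (subst measure_distr) auto
      finally show ?thesis using R[of n] by linarith
    qed
    then show "\<exists>a b. a < b \<and> (\<forall>n. measure (L n) {a<..b} > 1 - \<epsilon>)"
      by (intro exI[of _ "-1"] exI[of _ "2 * real k + 1"]) auto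
  qed
  then obtain r M where r: "strict_mono r" and M: "real_distribution M"
    and conv: "weak_conv_m (L \<circ> id \<circ> r) M"
    using tight_imp_convergent_subsubsequence[of L id] by (auto simp: strict_mono_id)
  interpret M: real_distribution M by (rule M)
  have \<phi>M [measurable]: "\<phi> \<in> measurable M borel" by measurable
  have "(\<lambda>n. \<integral>x. f x \<partial>P (r n)) \<longlonglongrightarrow> (\<integral>x. f x \<partial>distr M borel \<phi>)"
    if f: "continuous_on UNIV f" "bounded (range f)" for f :: "'a \<Rightarrow> real"
  proof -
    obtain B where B: "\<And>x. norm (f x) \<le> B" using f(2) by (auto simp: bounded_iff)
    have [measurable]: "f \<in> borel_measurable borel" by (rule borel_measurable_continuous_onI[OF f(1)])
    have "continuous_on UNIV (\<lambda>t. f (\<phi> t))"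
      using continuous_on_compose2[OF f(1) \<phi>(1)] by auto
    then have "isCont (\<lambda>t. f (\<phi> t)) t" for t by (simp add: continuous_on_eq_continuous_at)
    then have "(\<lambda>n. \<integral>t. f (\<phi> t) \<partial>(L \<circ> id \<circ> r) n) \<longlonglongrightarrow> (\<integral>t. f (\<phi> t) \<partial>M)"
      using L B by (intro weak_conv_imp_integral_bdd_continuous_conv[OF _ M conv]) auto
    moreover have "(\<integral>t. f (\<phi> t) \<partial>(L \<circ> id \<circ> r) n) = (\<integral>x. f x \<partial>P (r n))" for n
      by (simp add: L_def integral_distr s(2))
    moreover have "(\<integral>t. f (\<phi> t) \<partial>M) = (\<integral>x. f x \<partial>distr M borel \<phi>)"
      by (subst integral_distr) auto
    ultimately show ?thesis by simp
  qed
  then show thesis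
    by (intro that[OF r M.prob_space_distr[OF \<phi>M]]) auto
qed

text \<open>
  Prokhorov's theorem for finite measures. After passing to a subsequence the total masses converge to
  some \<open>l\<close>. If \<open>l = 0\<close> the limit is the zero measure; otherwise the masses are eventually above \<open>l / 2\<close>, so
  normalisation preserves tightness.
\<close>

theorem tight_finite_measures_narrow_subsequence:
  fixes \<nu> :: "nat \<Rightarrow> 'a::euclidean_space measure"
  assumes sets: "\<And>n. sets (\<nu> n) = sets borel"
    and bdd: "\<And>n. emeasure (\<nu> n) UNIV \<le> ennreal C"
    and tight: "\<And>\<epsilon>::real. \<epsilon> > 0 \<Longrightarrow> \<exists>R. \<forall>n. emeasure (\<nu> n) (UNIV - cball 0 R) \<le> ennreal \<epsilon>"
  obtains r \<nu>' where "strict_mono (r :: nat \<Rightarrow> nat)" "finite_measure \<nu>'" "sets \<nu>' = sets borel"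
    "\<And>f :: 'a \<Rightarrow> real. continuous_on UNIV f \<Longrightarrow> bounded (range f) \<Longrightarrow>
       (\<lambda>n. \<integral>x. f x \<partial>\<nu> (r n)) \<longlonglongrightarrow> (\<integral>x. f x \<partial>\<nu>')"
proof -
  have [measurable_cong]: "sets (\<nu> n) = sets borel" for n by (rule sets)
  have space: "space (\<nu> n) = UNIV" for n using sets_eq_imp_space_eq[OF sets] by simp
  have fin: "finite_measure (\<nu> n)" for n
    using bdd[of n] by (intro finite_measureI) (auto simp: space top_unique)
  define m where "m n = measure (\<nu> n) UNIV" for n
  have em: "emeasure (\<nu> n) UNIV = ennreal (m n)" for n
    using finite_measure.emeasure_eq_measure[OF fin] by (simp add: m_def)
  have m: "0 \<le> m n" "m n \<le> max 0 C" for n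
    using bdd[of n] unfolding em by (auto simp: m_def ennreal_le_iff2)
  have "compact {0..max 0 C}" "\<forall>n. m n \<in> {0..max 0 C}" using m by auto
  then obtain l r0 where r0: "strict_mono (r0 :: nat \<Rightarrow> nat)" and l: "l \<in> {0..max 0 C}"
    and lim: "(m \<circ> r0) \<longlonglongrightarrow> l"
    unfolding compact_def by blast
  have int_bound: "\<bar>\<integral>x. f x \<partial>\<nu> n\<bar> \<le> B * m n"
    if "continuous_on UNIV f" "\<And>x. \<bar>f x\<bar> \<le> B" for f n B
  proof -
    interpret finite_measure "\<nu> n" by (rule fin)
    have [measurable]: "f \<in> borel_measurable borel" by (rule borel_measurable_continuous_onI[OF that(1)])
    have "integrable (\<nu> n) f" using that by (intro integrable_const_bound[of _ B]) auto
    then have "\<bar>\<integral>x. f x \<partial>\<nu> n\<bar> \<le> (\<integral>x. B \<partial>\<nu> n)"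
      using that by (intro order_trans[OF integral_abs_bound] integral_mono) auto
    then show ?thesis by (simp add: m_def space mult.commute)
  qed
  show thesis
  proof (cases "l = 0")
    case True
    have "(\<lambda>n. \<integral>x. f x \<partial>\<nu> (r0 n)) \<longlonglongrightarrow> (\<integral>x. f x \<partial>null_measure borel)"
      if f: "continuous_on UNIV f" "bounded (range f)" for f :: "'a \<Rightarrow> real"
    proof -
      obtain B where B: "\<And>x. \<bar>f x\<bar> \<le> B" using f(2) by (auto simp: bounded_iff)
      have "(\<lambda>n. B * m (r0 n)) \<longlonglongrightarrow> B * 0"
        using lim True by (intro tendsto_intros) (simp add: comp_def)
      then have lim0: "(\<lambda>n. B * m (r0 n)) \<longlonglongrightarrow> 0" by simp
      have "\<forall>\<^sub>F n in sequentially. norm (\<integral>x. f x \<partial>\<nu> (r0 n)) \<le> B * m (r0 n)"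
        using int_bound[OF f(1) B] by (intro always_eventually allI) (simp only: real_norm_def)
      then have "(\<lambda>n. \<integral>x. f x \<partial>\<nu> (r0 n)) \<longlonglongrightarrow> 0"
        by (rule Lim_null_comparison[OF _ lim0])
      moreover have "(\<integral>x. f x \<partial>(null_measure borel)) = 0"
        by (intro integral_eq_zero_AE AE_I[of _ _ UNIV]) auto
      ultimately show ?thesis by simp
    qed
    then show thesis
      using r0 by (intro that[of r0 "null_measure borel"]) (auto intro!: finite_measureI)
  next
    case False
    with l have lpos: "l > 0" by auto
    then have "\<forall>\<^sub>F n in sequentially. l / 2 < (m \<circ> r0) n"
      using order_tendstoD(1)[OF lim, of "l / 2"] by auto
    then obtain n0 where n0: "\<And>n. n \<ge> n0 \<Longrightarrow> l / 2 < m (r0 n)"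
      by (auto simp: eventually_sequentially)
    define r1 where "r1 n = r0 (n + n0)" for n
    have r1: "strict_mono r1" using r0 by (auto simp: r1_def strict_mono_def)
    have m1: "l / 2 < m (r1 n)" for n unfolding r1_def by (rule n0) simp
    have lim1: "(\<lambda>n. m (r1 n)) \<longlonglongrightarrow> l"
      using LIMSEQ_ignore_initial_segment[OF lim, of n0] by (simp add: r1_def comp_def)
    define P where "P n = density (\<nu> (r1 n)) (\<lambda>_. ennreal (1 / m (r1 n)))" for n
    have P_meas: "measure (P n) A = measure (\<nu> (r1 n)) A / m (r1 n)" if "A \<in> sets borel" for n A
      unfolding P_def using that m[of "r1 n"] by (subst measure_density_const) (auto simp: sets)
    have P_sets: "sets (P n) = sets borel" for n by (simp add: P_def sets)
    have P_prob: "prob_space (P n)" for n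
    proof (rule prob_spaceI)
      have mp: "m (r1 n) > 0" using m1[of n] lpos by simp
      have "emeasure (P n) (space (P n)) = ennreal (1 / m (r1 n)) * ennreal (m (r1 n))"
        unfolding P_def by (subst emeasure_density_const) (auto simp: space em sets)
      also have "\<dots> = 1" using mp by (simp add: ennreal_mult[symmetric])
      finally show "emeasure (P n) (space (P n)) = 1" .
    qed
    have P_tight: "\<exists>R. \<forall>n. measure (P n) (cball 0 R) > 1 - \<epsilon>" if "\<epsilon> > 0" for \<epsilon> :: real
    proof -
      \<comment> \<open>Dividing by a mass above \<open>l / 2\<close> turns a tail of at most \<open>\<epsilon> l / 4\<close> into one of at most \<open>\<epsilon> / 2\<close>.\<close>
      have e: "\<epsilon> * l / 4 > 0" using that lpos by simp
      from tight[OF this] obtain R where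
        R: "\<And>n. emeasure (\<nu> n) (UNIV - cball 0 R) \<le> ennreal (\<epsilon> * l / 4)" by blast
      have "measure (P n) (cball 0 R) > 1 - \<epsilon>" for n
      proof -
        interpret \<nu>: finite_measure "\<nu> (r1 n)" by (rule fin)
        have mp: "m (r1 n) > 0" using m1[of n] lpos by simp
        have "measure (\<nu> (r1 n)) (UNIV - cball 0 R) \<le> \<epsilon> * l / 4"
          using R[of "r1 n"] e by (simp add: \<nu>.emeasure_eq_measure ennreal_le_iff)
        moreover have "measure (\<nu> (r1 n)) (UNIV - cball 0 R) = m (r1 n) - measure (\<nu> (r1 n)) (cball 0 R)"
          using \<nu>.finite_measure_compl[of "cball 0 R"] by (simp add: space m_def sets)
        moreover have "\<epsilon> * l / 4 < \<epsilon> * m (r1 n)"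
          using mult_strict_left_mono[OF m1[of n] that] that lpos mult_pos_pos[OF that lpos] by linarith
        ultimately have "measure (\<nu> (r1 n)) (cball 0 R) > (1 - \<epsilon>) * m (r1 n)"
          by (simp add: algebra_simps)
        then show ?thesis using mp by (simp add: P_meas field_simps)
      qed
      then show ?thesis by blast
    qed
    obtain r2 Q where r2: "strict_mono (r2 :: nat \<Rightarrow> nat)" and Q: "prob_space Q" "sets Q = sets borel"
      and conv: "\<And>f :: 'a \<Rightarrow> real. continuous_on UNIV f \<Longrightarrow> bounded (range f) \<Longrightarrow>
        (\<lambda>n. \<integral>x. f x \<partial>P (r2 n)) \<longlonglongrightarrow> (\<integral>x. f x \<partial>Q)"
      using tight_prob_measures_narrow_subsequence[OF P_prob P_sets P_tight] by metis
    have [measurable_cong]: "sets Q = sets borel" by (rule Q(2))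
    interpret Q: prob_space Q by (rule Q(1))
    define \<nu>' where "\<nu>' = density Q (\<lambda>_. ennreal l)"
    have "(\<lambda>n. \<integral>x. f x \<partial>\<nu> (r1 (r2 n))) \<longlonglongrightarrow> (\<integral>x. f x \<partial>\<nu>')"
      if f: "continuous_on UNIV f" "bounded (range f)" for f :: "'a \<Rightarrow> real"
    proof -
      have [measurable]: "f \<in> borel_measurable borel" by (rule borel_measurable_continuous_onI[OF f(1)])
      have "(\<lambda>n. m (r1 (r2 n)) * (\<integral>x. f x \<partial>P (r2 n))) \<longlonglongrightarrow> l * (\<integral>x. f x \<partial>Q)"
        using LIMSEQ_subseq_LIMSEQ[OF lim1 r2] by (intro tendsto_mult conv f) (simp add: comp_def)
      moreover have "m (r1 (r2 n)) * (\<integral>x. f x \<partial>P (r2 n)) = (\<integral>x. f x \<partial>\<nu> (r1 (r2 n)))" for n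
      proof -
        have mp: "m (r1 (r2 n)) > 0" using m1[of "r2 n"] lpos by simp
        then have "(\<integral>x. f x \<partial>P (r2 n)) = (\<integral>x. (1 / m (r1 (r2 n))) *\<^sub>R f x \<partial>\<nu> (r1 (r2 n)))"
          unfolding P_def by (subst integral_density) auto
        then show ?thesis using mp by simp
      qed
      moreover have "(\<integral>x. f x \<partial>\<nu>') = l * (\<integral>x. f x \<partial>Q)"
        unfolding \<nu>'_def using lpos by (subst integral_density) auto
      ultimately show ?thesis by simp
    qed
    moreover have "finite_measure \<nu>'"
      unfolding \<nu>'_def
      by (intro finite_measureI) (auto simp: emeasure_density_const Q.emeasure_space_1 ennreal_mult_less_top)
    ultimately show thesis
      using strict_mono_compose[OF r1 r2] Q(2)
      by (intro that[of "\<lambda>n. r1 (r2 n)" \<nu>']) (auto simp: \<nu>'_def strict_mono_def)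
  qed
qed

section \<open>Growth of Hausdorff measure on affine subspaces\<close>

lemma hausdorff_content_le_finite_sum:
  assumes fin: "finite I" and \<delta>: "0 \<le> \<delta>"
    and C: "\<And>i. i \<in> I \<Longrightarrow> bounded (C i)" "\<And>i. i \<in> I \<Longrightarrow> diameter (C i) \<le> \<delta>" "A \<subseteq> (\<Union>i\<in>I. C i)"
  shows "hausdorff_content n \<delta> A \<le> (\<Sum>i\<in>I. hausdorff_weight n (C i))"
proof -
  obtain e where e: "bij_betw e {0..<card I} I" using ex_bij_betw_nat_finite[OF fin] by blast
  define D where "D k = (if k < card I then C (e k) else {})" for k
  have eI: "e k \<in> I" if "k < card I" for k using e that by (auto simp: bij_betw_def)
  have "hausdorff_content n \<delta> A \<le> (\<Sum>k. hausdorff_weight n (D k))"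
  proof (rule hausdorff_content_le)
    show "bounded (D k)" "diameter (D k) \<le> \<delta>" for k using C eI \<delta> by (auto simp: D_def)
    show "A \<subseteq> (\<Union>k. D k)"
    proof
      fix x assume "x \<in> A"
      then obtain i where i: "i \<in> I" "x \<in> C i" using C(3) by auto
      then have "i \<in> e ` {0..<card I}" using e by (simp add: bij_betw_def)
      then obtain k where "k < card I" "i = e k" by auto
      then show "x \<in> (\<Union>k. D k)" using i by (auto simp: D_def intro!: exI[of _ k])
    qed
  qed
  also have "\<dots> = (\<Sum>k\<in>{0..<card I}. hausdorff_weight n (D k))"
    by (rule suminf_finite) (auto simp: D_def hausdorff_weight_def)
  also have "\<dots> = (\<Sum>k\<in>{0..<card I}. hausdorff_weight n (C (e k)))"
    by (rule sum.cong) (auto simp: D_def)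
  also have "\<dots> = (\<Sum>i\<in>I. hausdorff_weight n (C i))"
    by (rule sum.reindex_bij_betw[OF e])
  finally show ?thesis .
qed

text \<open>
  A grid of cubes of side \<open>s\<close> in an orthonormal frame. With \<open>n = card B\<close>, covering the ball of radius \<open>R\<close>
  takes at most \<open>(2 \<lceil>R / s\<rceil> + 1)\<^sup>n\<close> cubes of diameter at most \<open>s n\<close>, so the factor \<open>s\<^sup>n\<close> cancels and the
  bound does not depend on the mesh. The constant \<open>5 / 2\<close> comes from \<open>(2 (R / s + 1) + 1) s \<le> 5 R\<close>.
\<close>

lemma hausdorff_content_span_ball_le:
  fixes B :: "'a::euclidean_space set" and a :: 'a
  assumes B: "pairwise orthogonal B" "\<And>b. b \<in> B \<Longrightarrow> norm b = 1" "finite B"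
    and s: "0 < s" "s \<le> R" "s * real (card B) \<le> \<delta>"
  shows "hausdorff_content (card B) \<delta> {x. x - a \<in> span B \<and> norm (x - a) \<le> R}
    \<le> ennreal (unit_ball_vol (card B) * (5 / 2 * card B * R) ^ card B)"
proof -
  define n where "n = card B"
  define m where "m = nat \<lceil>R / s\<rceil>"
  have m: "R \<le> m * s" "m * s \<le> R + s"
  proof -
    have "0 \<le> R / s" using s by simp
    then have "R / s \<le> m" "m \<le> R / s + 1" unfolding m_def by linarith+
    then show "R \<le> m * s" "m * s \<le> R + s" using s by (auto simp: field_simps)
  qed
  define I where "I = (B \<rightarrow>\<^sub>E {- int m..int m})"
  \<comment> \<open>\<open>Q k\<close> is the grid cube with lower corner \<open>s k\<close>. Its diameter is estimated by its \<open>\<ell>\<^sup>1\<close> diameter \<open>s n\<close>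
    instead of the sharp \<open>s \<surd>n\<close>.\<close>
  define Q where "Q k = {a + (\<Sum>b\<in>B. c b *\<^sub>R b) | c. \<forall>b\<in>B. s * of_int (k b) \<le> c b \<and> c b \<le> s * (of_int (k b) + 1)}"
    for k :: "'a \<Rightarrow> int"
  have Qdist: "norm (x - y) \<le> s * n" if xy: "x \<in> Q k" "y \<in> Q k" for x y k
  proof -
    obtain c where c: "x = a + (\<Sum>b\<in>B. c b *\<^sub>R b)" "\<And>b. b \<in> B \<Longrightarrow> s * of_int (k b) \<le> c b \<and> c b \<le> s * (of_int (k b) + 1)"
      using xy(1) by (auto simp: Q_def)
    obtain d where d: "y = a + (\<Sum>b\<in>B. d b *\<^sub>R b)" "\<And>b. b \<in> B \<Longrightarrow> s * of_int (k b) \<le> d b \<and> d b \<le> s * (of_int (k b) + 1)"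
      using xy(2) by (auto simp: Q_def)
    have "norm (x - y) = norm (\<Sum>b\<in>B. (c b - d b) *\<^sub>R b)"
      by (simp add: c(1) d(1) sum_subtractf[symmetric] scaleR_left_diff_distrib)
    also have "\<dots> \<le> (\<Sum>b\<in>B. s)"
    proof (rule order_trans[OF norm_sum sum_mono])
      fix b assume b: "b \<in> B"
      show "norm ((c b - d b) *\<^sub>R b) \<le> s"
        unfolding norm_scaleR B(2)[OF b] using c(2)[OF b] d(2)[OF b]
        by (simp add: algebra_simps abs_le_iff)
    qed
    finally show ?thesis by (simp add: n_def mult.commute)
  qed
  have Qne: "Q k \<noteq> {}" for k
    using s by (auto simp: Q_def intro!: exI[of _ "\<lambda>b. s * of_int (k b)"])
  have diam: "diameter (Q k) \<le> s * n" for k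
    using Qne Qdist by (intro diameter_le) auto
  have bdd: "bounded (Q k)" for k
    using Qne[of k] Qdist[of _ k] unfolding bounded_def dist_norm by blast
  have weight: "hausdorff_weight n (Q k) \<le> ennreal (unit_ball_vol n * (s * n / 2) ^ n)" for k
    unfolding hausdorff_weight_def using diam[of k] diameter_ge_0[OF bdd[of k]]
    by (auto intro!: ennreal_leI mult_left_mono power_mono)
  have card_int: "card {- int m..int m} = 2 * m + 1"
    unfolding card_atLeastAtMost_int by linarith
  have "hausdorff_content n \<delta> {x. x - a \<in> span B \<and> norm (x - a) \<le> R} \<le> (\<Sum>k\<in>I. hausdorff_weight n (Q k))"
  proof (rule hausdorff_content_le_finite_sum)
    show "finite I" unfolding I_def by (intro finite_PiE B(3)) auto
    show "0 \<le> \<delta>" using s mult_nonneg_nonneg[of s "real (card B)"] by linarith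
    show "bounded (Q k)" for k by (rule bdd)
    show "diameter (Q k) \<le> \<delta>" for k using diam[of k] s(3) by (simp add: n_def)
    show "{x. x - a \<in> span B \<and> norm (x - a) \<le> R} \<subseteq> (\<Union>k\<in>I. Q k)"
    proof clarify
      fix x assume x: "x - a \<in> span B" "norm (x - a) \<le> R"
      define c where "c b = (x - a) \<bullet> b" for b
      have "x - a = (\<Sum>b\<in>B. c b *\<^sub>R b)"
        unfolding c_def using orthonormal_basis_expand[OF B(1,2) x(1) B(3)] by simp
      then have xc: "x = a + (\<Sum>b\<in>B. c b *\<^sub>R b)" by (simp add: algebra_simps)
      have cR: "\<bar>c b\<bar> \<le> R" if "b \<in> B" for b
        using Cauchy_Schwarz_ineq2[of "x - a" b] B(2)[OF that] x(2) by (simp add: c_def)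
      define k where "k = restrict (\<lambda>b. \<lfloor>c b / s\<rfloor>) B"
      have "k \<in> I"
        unfolding I_def
      proof (rule PiE_I)
        fix b assume b: "b \<in> B"
        have "- real m \<le> c b / s" "c b / s \<le> real m"
          using cR[OF b] m(1) s(1) by (auto simp: abs_le_iff field_simps)
        then have "- int m \<le> \<lfloor>c b / s\<rfloor>" "\<lfloor>c b / s\<rfloor> \<le> int m" by linarith+
        then show "k b \<in> {- int m..int m}" using b by (simp add: k_def)
      qed (simp add: k_def)
      moreover have "x \<in> Q k"
        unfolding Q_def mem_Collect_eq
      proof (intro exI[of _ c] conjI xc ballI)
        fix b assume b: "b \<in> B"
        have "of_int (k b) \<le> c b / s" "c b / s \<le> of_int (k b) + 1" using b by (auto simp: k_def)
        then show "s * of_int (k b) \<le> c b" "c b \<le> s * (of_int (k b) + 1)"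
          using s(1) by (auto simp: field_simps)
      qed
      ultimately show "x \<in> (\<Union>k\<in>I. Q k)" by blast
    qed
  qed
  also have "\<dots> \<le> (\<Sum>k\<in>I. ennreal (unit_ball_vol n * (s * n / 2) ^ n))"
    by (intro sum_mono weight)
  also have "\<dots> = ennreal (card I * (unit_ball_vol n * (s * n / 2) ^ n))"
    by (simp add: ennreal_mult' ennreal_of_nat_eq_real_of_nat)
  also have "card I = (2 * m + 1) ^ n"
    unfolding I_def using card_int by (simp only: card_PiE[OF B(3)] prod_constant n_def)
  also have "real ((2 * m + 1) ^ n) * (unit_ball_vol n * (s * n / 2) ^ n)
      = unit_ball_vol n * ((2 * m + 1) * s * n / 2) ^ n"
    by (simp add: power_mult_distrib power_divide)
  also have "ennreal \<dots> \<le> ennreal (unit_ball_vol n * (5 / 2 * n * R) ^ n)"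
  proof (intro ennreal_leI mult_left_mono power_mono)
    have "(2 * m + 1) * s \<le> 5 * R" using m(2) s(2) by (simp add: algebra_simps)
    then have "(2 * m + 1) * s * n \<le> 5 * R * n" by (rule mult_right_mono) simp
    then show "(2 * m + 1) * s * n / 2 \<le> 5 / 2 * n * R" by (simp add: field_simps)
  qed (use s(1) in auto)
  finally show ?thesis by (simp add: n_def)
qed

text \<open>
  The bound on the content at scale \<open>\<delta>\<close> is uniform in \<open>\<delta>\<close>, because the mesh of the grid may be chosen as small
  as \<open>\<delta>\<close> requires. The constant is far from sharp.
\<close>

theorem hausdorff_outer_affine_cball_le:
  fixes E :: "'a::euclidean_space set"
  assumes E: "affine E" "aff_dim E = int n" and R: "0 < R" "a \<in> E"
  shows "hausdorff_outer n (E \<inter> cball a R) \<le> ennreal (unit_ball_vol n * (5 / 2 * n * R) ^ n)"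
proof -
  define S where "S = (\<lambda>x. x - a) ` E"
  have S: "subspace S"
    using affine_diffs_subspace_subtract[OF E(1) R(2)] by (simp add: S_def)
  have "aff_dim S = int n"
    using aff_dim_translation_eq_subtract[of a E] E(2) by (simp add: S_def)
  then have dimS: "dim S = n" using aff_dim_subspace[OF S] by simp
  obtain B where B: "pairwise orthogonal B" "\<And>x. x \<in> B \<Longrightarrow> norm x = 1"
      "independent B" "card B = n" "span B = S"
    using orthonormal_basis_subspace[OF S] dimS by metis
  have finB: "finite B" using B(3) by (rule independent_imp_finite)
  have sub: "E \<inter> cball a R \<subseteq> {x. x - a \<in> span B \<and> norm (x - a) \<le> R}"
    by (auto simp: B(5) S_def dist_norm norm_minus_commute)
  show ?thesis
    unfolding hausdorff_outer_def
  proof (rule SUP_least)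
    fix \<delta> :: real assume "\<delta> \<in> {0<..}"
    then have \<delta>: "\<delta> > 0" by simp
    define s where "s = min R (\<delta> / (real n + 1))"
    have "s * n \<le> \<delta> / (real n + 1) * n" by (intro mult_right_mono) (auto simp: s_def)
    also have "\<dots> \<le> \<delta>" using \<delta> by (simp add: field_simps)
    finally have "s * card B \<le> \<delta>" using B(4) by simp
    then have "hausdorff_content n \<delta> {x. x - a \<in> span B \<and> norm (x - a) \<le> R}
      \<le> ennreal (unit_ball_vol n * (5 / 2 * n * R) ^ n)"
      using hausdorff_content_span_ball_le[OF B(1,2) finB, of s R \<delta> a] \<delta> R by (simp add: s_def B(4))
    then show "hausdorff_content n \<delta> (E \<inter> cball a R) \<le> ennreal (unit_ball_vol n * (5 / 2 * n * R) ^ n)"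
      by (rule order_trans[OF hausdorff_content_mono[OF sub]])
  qed
qed

lemma hausdorff_measure_affine_growth:
  fixes E :: "'a::euclidean_space set"
  assumes E: "affine E" "aff_dim E = int n"
  obtains C where "\<And>R. 1 \<le> R \<Longrightarrow>
    emeasure (density (hausdorff_measure n) (indicator E)) (cball 0 R) \<le> ennreal (C * R ^ n)"
proof -
  have "E \<noteq> {}" using E(2) by auto
  then obtain a where a: "a \<in> E" by blast
  define C where "C = unit_ball_vol n * (5 / 2 * n * (1 + norm a)) ^ n"
  have "emeasure (density (hausdorff_measure n) (indicator E)) (cball 0 R) \<le> ennreal (C * R ^ n)"
    if R: "1 \<le> R" for R
  proof -
    have Eb: "E \<in> sets borel" using affine_closed[OF E(1)] by (rule borel_closed)
    have r: "R + norm a \<le> (1 + norm a) * R" using mult_left_mono[OF R norm_ge_zero[of a]]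
      by (simp add: algebra_simps)
    have "emeasure (density (hausdorff_measure n) (indicator E)) (cball 0 R)
        = hausdorff_outer n (E \<inter> cball 0 R)"
      using Eb by (subst emeasure_restricted) (auto simp: emeasure_hausdorff_measure)
    also have "\<dots> \<le> hausdorff_outer n (E \<inter> cball a ((1 + norm a) * R))"
    proof (rule hausdorff_outer_mono, safe)
      fix x assume "x \<in> cball (0 :: 'a) R"
      then show "x \<in> cball a ((1 + norm a) * R)"
        using r norm_triangle_ineq4[of a x] by (simp add: dist_norm)
    qed
    also have "\<dots> \<le> ennreal (unit_ball_vol n * (5 / 2 * n * ((1 + norm a) * R)) ^ n)"
      using R by (intro hausdorff_outer_affine_cball_le E a mult_pos_pos add_pos_nonneg) auto
    also have "unit_ball_vol n * (5 / 2 * n * ((1 + norm a) * R)) ^ n = C * R ^ n"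
      by (simp only: C_def power_mult_distrib mult_ac)
    finally show ?thesis .
  qed
  then show thesis by (rule that)
qed

section \<open>Gaussian integrals\<close>

text \<open>
  A crude form of \<open>x\<^sup>k \<le> k! e\<^sup>x\<close>, obtained from \<open>(1 + x / k)\<^sup>k \<le> e\<^sup>x\<close>.
\<close>

lemma power_le_exp:
  fixes x :: real
  assumes "0 \<le> x"
  shows "x ^ k \<le> real k ^ k * exp x"
proof (cases "k = 0")
  case False
  have "(x / k) ^ k \<le> (1 + x / k) ^ k"
    using assms by (intro power_mono) auto
  also have "\<dots> \<le> exp x"
    using assms False by (intro exp_ge_one_plus_x_over_n_power_n) auto
  finally show ?thesis using False by (simp add: power_divide field_simps)
qed (use assms in simp)

lemma summable_gaussian_power:
  fixes c :: real
  assumes "c > 0"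
  shows "summable (\<lambda>j. exp (- c * (real j)\<^sup>2) * (real j + 1) ^ k)"
proof (rule summable_comparison_test')
  \<comment> \<open>Half of the decay \<open>exp (- c j)\<close> absorbs the power of \<open>j + 1\<close>, the other half is a convergent geometric
    series.\<close>
  define K where "K = (2 / c) ^ k * real k ^ k * exp (c / 2)"
  have "summable (\<lambda>j. exp (- c / 2) ^ j)"
    using assms by (intro summable_geometric) simp
  then show "summable (\<lambda>j. K * exp (- c / 2) ^ j)"
    by (rule summable_mult)
  show "norm (exp (- c * (real j)\<^sup>2) * (real j + 1) ^ k) \<le> K * exp (- c / 2) ^ j" if "0 \<le> j" for j
  proof -
    have "2 / c * (c / 2 * (real j + 1)) = real j + 1"
      using assms by simp
    then have "(real j + 1) ^ k = (2 / c * (c / 2 * (real j + 1))) ^ k"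
      by (simp only:)
    also have "\<dots> = (2 / c) ^ k * (c / 2 * (real j + 1)) ^ k"
      by (rule power_mult_distrib)
    also have "\<dots> \<le> (2 / c) ^ k * (real k ^ k * exp (c / 2 * (real j + 1)))"
      using assms by (intro mult_left_mono power_le_exp) auto
    finally have 1: "(real j + 1) ^ k \<le> (2 / c) ^ k * (real k ^ k * exp (c / 2 * (real j + 1)))" .
    have "real j \<le> (real j)\<^sup>2"
      by (cases j) (auto simp: power2_eq_square)
    then have 2: "exp (- c * (real j)\<^sup>2) \<le> exp (- c * real j)" using assms by simp
    have "norm (exp (- c * (real j)\<^sup>2) * (real j + 1) ^ k)
        \<le> exp (- c * real j) * ((2 / c) ^ k * (real k ^ k * exp (c / 2 * (real j + 1))))"
      using mult_mono[OF 2 1] by simp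
    also have "\<dots> = (2 / c) ^ k * real k ^ k * (exp (- c * real j) * exp (c / 2 * (real j + 1)))"
      by (simp add: mult_ac)
    also have "exp (- c * real j) * exp (c / 2 * (real j + 1)) = exp (c / 2) * exp (- c / 2) ^ j"
    proof -
      have "- c * real j + c / 2 * (real j + 1) = c / 2 + real j * (- c / 2)"
        by (simp add: field_simps)
      then show ?thesis by (simp only: exp_add[symmetric] exp_of_nat_mult[symmetric])
    qed
    finally show ?thesis by (simp add: K_def mult_ac)
  qed
qed

text \<open>
  On the shell \<open>j \<le> \<parallel>z\<parallel> \<le> j + 1\<close> the Gaussian is at most \<open>exp (- c j\<^sup>2)\<close>, and the shell has measure at most
  of order \<open>(j + 1)\<^sup>k\<close>. The hypothesis covers both Lebesgue measure and Hausdorff measure on an affine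
  subspace.
\<close>

lemma gaussian_integral_finite_of_polynomial_growth:
  fixes M :: "'a::real_normed_vector measure"
  assumes sets: "sets M = sets borel"
    and growth: "\<And>R. 1 \<le> R \<Longrightarrow> emeasure M (cball 0 R) \<le> ennreal (C * R ^ k)"
    and c: "c > 0"
  shows "(\<integral>\<^sup>+z. ennreal (exp (- c * (norm z)\<^sup>2)) \<partial>M) < \<infinity>"
proof -
  have [measurable]: "cball 0 R \<in> sets M" for R by (simp add: sets)
  have shells: "ennreal (exp (- c * (norm z)\<^sup>2))
      \<le> (\<Sum>j. ennreal (exp (- c * (real j)\<^sup>2)) * indicator (cball 0 (real j + 1)) z)" for z :: 'a
  proof -
    define j where "j = nat \<lfloor>norm z\<rfloor>"
    have j: "real j \<le> norm z" "norm z \<le> real j + 1"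
      unfolding j_def using norm_ge_zero[of z] by linarith+
    have "ennreal (exp (- c * (norm z)\<^sup>2)) \<le> ennreal (exp (- c * (real j)\<^sup>2))"
      using j c by (intro ennreal_leI) (simp add: power_mono)
    also have "\<dots> = (\<Sum>j\<in>{j}. ennreal (exp (- c * (real j)\<^sup>2)) * indicator (cball 0 (real j + 1)) z)"
      using j by simp
    also have "\<dots> \<le> (\<Sum>j. ennreal (exp (- c * (real j)\<^sup>2)) * indicator (cball 0 (real j + 1)) z)"
      by (rule sum_le_suminf) auto
    finally show ?thesis .
  qed
  have "(\<integral>\<^sup>+z. ennreal (exp (- c * (norm z)\<^sup>2)) \<partial>M)
      \<le> (\<integral>\<^sup>+z. (\<Sum>j. ennreal (exp (- c * (real j)\<^sup>2)) * indicator (cball 0 (real j + 1)) z) \<partial>M)"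
    by (intro nn_integral_mono shells)
  also have "\<dots> = (\<Sum>j. ennreal (exp (- c * (real j)\<^sup>2)) * emeasure M (cball 0 (real j + 1)))"
    by (subst nn_integral_suminf) (auto simp: nn_integral_cmult_indicator)
  also have "\<dots> \<le> (\<Sum>j. ennreal (exp (- c * (real j)\<^sup>2) * (max 0 C * (real j + 1) ^ k)))"
  proof (intro suminf_le summableI)
    fix j
    have "emeasure M (cball 0 (real j + 1)) \<le> ennreal (C * (real j + 1) ^ k)"
      by (rule growth) simp
    also have "\<dots> \<le> ennreal (max 0 C * (real j + 1) ^ k)"
      by (intro ennreal_leI mult_right_mono) auto
    finally show "ennreal (exp (- c * (real j)\<^sup>2)) * emeasure M (cball 0 (real j + 1))
        \<le> ennreal (exp (- c * (real j)\<^sup>2) * (max 0 C * (real j + 1) ^ k))"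
      by (simp add: ennreal_mult mult_left_mono)
  qed
  also have "\<dots> < \<infinity>"
  proof -
    have "summable (\<lambda>j. exp (- c * (real j)\<^sup>2) * (max 0 C * (real j + 1) ^ k))"
      using summable_mult[OF summable_gaussian_power[OF c, of k], of "max 0 C"]
      by (simp only: mult.left_commute)
    then show ?thesis
      unfolding infinity_ennreal_def less_top[symmetric] by (rule ennreal_suminf_neq_top) auto
  qed
  finally show ?thesis .
qed

text \<open>
  The normalising constant of the thermal weight is a Bochner integral, which would be \<open>0\<close> if the Gaussian
  were not integrable.
\<close>

lemma gaussian_lborel:
  fixes \<beta> :: real
  assumes \<beta>: "\<beta> > 0"
  defines "B \<equiv> (\<integral>\<xi>. exp (- \<beta> * (norm \<xi>)\<^sup>2) \<partial>(lborel :: 'a::euclidean_space measure))"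
  shows "B > 0"
    and "(\<integral>\<^sup>+\<xi>. ennreal (exp (- \<beta> * (norm \<xi>)\<^sup>2)) \<partial>(lborel :: 'a measure)) = ennreal B"
proof -
  let ?f = "\<lambda>\<xi>::'a. exp (- \<beta> * (norm \<xi>)\<^sup>2)"
  have "(\<integral>\<^sup>+\<xi>. ennreal (?f \<xi>) \<partial>lborel) < \<infinity>"
    by (rule gaussian_integral_finite_of_polynomial_growth[where k = "DIM('a)" and C = "unit_ball_vol DIM('a)"])
       (auto simp: emeasure_cball \<beta>)
  then have int: "integrable lborel ?f"
    by (intro integrableI_nonneg) auto
  then show eq: "(\<integral>\<^sup>+\<xi>. ennreal (?f \<xi>) \<partial>lborel) = ennreal B"
    unfolding B_def by (intro nn_integral_eq_integral) auto
  have "B \<noteq> 0"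
  proof
    assume "B = 0"
    then have "AE \<xi> in lborel. ?f \<xi> = 0"
      unfolding B_def using int by (subst (asm) integral_nonneg_eq_0_iff_AE) auto
    then have "AE \<xi> in (lborel :: 'a measure). False" by simp
    then have "emeasure (lborel :: 'a measure) UNIV = 0"
      by (subst (asm) AE_iff_measurable[of UNIV]) auto
    then show False by (simp add: emeasure_lborel_UNIV)
  qed
  moreover have "0 \<le> B" unfolding B_def by simp
  ultimately show "B > 0" by simp
qed

text \<open>
  Halving the exponent of the normalised Gaussian multiplies its integral by a factor independent of \<open>\<beta>\<close>: substitute
  \<open>y = z + \<surd>2 \<xi>\<close>. This is the source of all uniformity in \<open>\<beta>\<close>.
\<close>

lemma nn_integral_half_thermal_weight:
  fixes z :: "'a::euclidean_space"
  assumes \<beta>: "\<beta> > 0"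
  shows "(\<integral>\<^sup>+y. ennreal (inverse (\<integral>\<xi>. exp (- \<beta> * (norm \<xi>)\<^sup>2) \<partial>(lborel :: 'a measure))
           * exp (- (\<beta> / 2) * (norm (y - z))\<^sup>2)) \<partial>lborel) = ennreal (sqrt 2 ^ DIM('a))"
proof -
  define B where "B = (\<integral>\<xi>. exp (- \<beta> * (norm \<xi>)\<^sup>2) \<partial>(lborel :: 'a measure))"
  note B = gaussian_lborel[OF \<beta>, where 'a = 'a, folded B_def]
  let ?f = "\<lambda>y. ennreal (inverse B * exp (- (\<beta> / 2) * (norm (y - z))\<^sup>2))"
  have f: "?f (z + sqrt 2 *\<^sub>R \<xi>) = ennreal (inverse B) * ennreal (exp (- \<beta> * (norm \<xi>)\<^sup>2))" for \<xi>
    using B(1) by (simp add: ennreal_mult power_mult_distrib)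
  have "(\<integral>\<^sup>+y. ?f y \<partial>lborel)
      = (\<integral>\<^sup>+y. ?f y \<partial>density (distr lborel borel (\<lambda>\<xi>. z + sqrt 2 *\<^sub>R \<xi>)) (\<lambda>_. \<bar>sqrt 2\<bar> ^ DIM('a)))"
    by (subst lborel_affine[of "sqrt 2" z, symmetric]) auto
  also have "\<dots> = (\<integral>\<^sup>+\<xi>. ennreal (sqrt 2 ^ DIM('a)) * ?f (z + sqrt 2 *\<^sub>R \<xi>) \<partial>lborel)"
    by (subst nn_integral_density; (subst nn_integral_distr)?; simp)
  also have "\<dots> = ennreal (sqrt 2 ^ DIM('a)) * (ennreal (inverse B) * ennreal B)"
    unfolding f by (subst nn_integral_cmult, simp, subst nn_integral_cmult, simp, simp only: B(2))
  also have "ennreal (inverse B) * ennreal B = 1"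
    using B(1) by (simp add: ennreal_mult[symmetric])
  finally show ?thesis unfolding B_def by simp
qed

section \<open>Thermalization of confined product measures\<close>

lemma sigma_finite_of_finite_on_balls:
  fixes M :: "'a::real_normed_vector measure"
  assumes sets: "sets M = sets borel" and fin: "\<And>n. emeasure M (cball 0 (real n)) < \<infinity>"
  shows "sigma_finite_measure M"
proof
  have "x \<in> (\<Union>n. cball 0 (real n))" for x :: 'a
    using real_arch_simple[of "norm x"] by auto
  then have U: "(\<Union>n. cball 0 (real n)) = (UNIV :: 'a set)" by blast
  show "\<exists>A. countable A \<and> A \<subseteq> sets M \<and> \<Union> A = space M \<and> (\<forall>a\<in>A. emeasure M a \<noteq> \<infinity>)"
    using fin U sets_eq_imp_space_eq[OF sets]
    by (intro exI[of _ "range (\<lambda>n. cball 0 (real n))"]) (auto simp: sets less_top)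
qed

text \<open>
  \<open>H\<close> plays the role of \<open>\<H>\<^sup>N\<close> restricted to \<open>E\<close>. Polynomial growth of its balls is what makes it \<open>\<sigma>\<close>-finite
  and Gaussians integrable.
\<close>

locale gaussian_confinement =
  fixes \<Phi> :: "'a::euclidean_space \<Rightarrow> real" and H :: "'a measure"
    and \<beta>\<^sub>0 c b C :: real and k :: nat
  assumes \<Phi>_measurable [measurable]: "\<Phi> \<in> borel_measurable borel"
    and sets_H [measurable_cong]: "sets H = sets borel"
    and growth: "\<And>R. 1 \<le> R \<Longrightarrow> emeasure H (cball 0 R) \<le> ennreal (C * R ^ k)"
    and \<beta>\<^sub>0: "\<beta>\<^sub>0 > 0" and c: "c > 0"
    and confinement:
      "AE z in H. \<forall>y. \<beta>\<^sub>0 * (norm (y - z))\<^sup>2 + \<Phi> y \<ge> c * ((norm y)\<^sup>2 + (norm z)\<^sup>2) - b"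
begin

definition \<mu> :: "('a \<times> 'a) measure" where
  "\<mu> = density lborel (\<lambda>y. ennreal (exp (- \<Phi> y))) \<Otimes>\<^sub>M H"

lemma sets_\<mu>: "sets \<mu> = sets borel"
proof -
  have "sets \<mu> = sets (borel \<Otimes>\<^sub>M borel :: ('a \<times> 'a) measure)"
    unfolding \<mu>_def by (rule sets_pair_measure_cong) (auto simp: sets_H)
  then show ?thesis by (simp only: borel_prod)
qed

lemma pair_sigma_finite_factors: "pair_sigma_finite (density lborel (\<lambda>y. ennreal (exp (- \<Phi> y)))) H"
proof -
  have "emeasure H (cball 0 (real n)) < \<infinity>" for n
  proof -
    have "emeasure H (cball 0 (real n)) \<le> emeasure H (cball 0 (max 1 (real n)))"
      by (rule emeasure_mono) (auto simp: sets_H)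
    also have "\<dots> \<le> ennreal (C * max 1 (real n) ^ k)" by (rule growth) simp
    also have "\<dots> < \<infinity>" by simp
    finally show ?thesis .
  qed
  then have "sigma_finite_measure H" by (rule sigma_finite_of_finite_on_balls[OF sets_H])
  moreover have "sigma_finite_measure (density lborel (\<lambda>y. ennreal (exp (- \<Phi> y))))"
    by (subst sigma_finite_measure.sigma_finite_iff_density_finite[OF sigma_finite_lborel]) auto
  ultimately show ?thesis by (simp add: pair_sigma_finite_def)
qed

text \<open>
  The variable \<open>y\<close> is integrated first, since the thermal weight is normalised in \<open>y\<close> for fixed \<open>z\<close>.
\<close>

lemma nn_integral_\<mu>:
  assumes f: "f \<in> borel_measurable borel"
  shows "(\<integral>\<^sup>+x. f x \<partial>\<mu>) = (\<integral>\<^sup>+z. \<integral>\<^sup>+y. ennreal (exp (- \<Phi> y)) * f (y, z) \<partial>lborel \<partial>H)"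
proof -
  interpret pair_sigma_finite "density lborel (\<lambda>y. ennreal (exp (- \<Phi> y)))" H
    by (rule pair_sigma_finite_factors)
  have [measurable]: "f \<in> borel_measurable (borel \<Otimes>\<^sub>M borel)"
    using f by (simp add: borel_prod)
  have "(\<integral>\<^sup>+x. f x \<partial>\<mu>) = (\<integral>\<^sup>+z. \<integral>\<^sup>+y. f (y, z) \<partial>density lborel (\<lambda>y. ennreal (exp (- \<Phi> y))) \<partial>H)"
    unfolding \<mu>_def by (rule nn_integral_snd[symmetric]) measurable
  also have "\<dots> = (\<integral>\<^sup>+z. \<integral>\<^sup>+y. ennreal (exp (- \<Phi> y)) * f (y, z) \<partial>lborel \<partial>H)"
    by (intro nn_integral_cong nn_integral_density) measurable
  finally show ?thesis .
qed

lemma thermal_weight_measurable [measurable]: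
  "(\<lambda>(y, z). ennreal (thermal_weight \<beta> y z)) \<in> borel_measurable (borel :: ('a \<times> 'a) measure)"
  unfolding thermal_weight_def borel_prod[symmetric] by measurable

definition gaussian_mass :: ennreal where
  "gaussian_mass = (\<integral>\<^sup>+z. ennreal (exp (- (c / 2) * (norm z)\<^sup>2)) \<partial>H)"

lemma gaussian_mass_finite: "gaussian_mass < \<infinity>"
  unfolding gaussian_mass_def using c by (intro gaussian_integral_finite_of_polynomial_growth[OF sets_H growth]) auto

text \<open>
  For \<open>\<beta> \<ge> 2 \<beta>\<^sub>0\<close> half of the thermal exponent already pays for the confinement inequality, and the other half
  is kept to integrate over \<open>y\<close>. The Gaussian decay \<open>c \<parallel>(y, z)\<parallel>\<^sup>2\<close> gained this way is split as well: one half gives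
  smallness outside the ball of radius \<open>R\<close>, the other half integrability in \<open>z\<close>.
\<close>

lemma weighted_density_le:
  assumes \<beta>: "\<beta> \<ge> 2 * \<beta>\<^sub>0" and R: "0 \<le> R" "R \<le> norm (y, z)"
    and conf: "\<beta>\<^sub>0 * (norm (y - z))\<^sup>2 + \<Phi> y \<ge> c * ((norm y)\<^sup>2 + (norm z)\<^sup>2) - b"
  shows "exp (- \<Phi> y) * exp (- \<beta> * (norm (y - z))\<^sup>2)
    \<le> exp (b - c / 2 * R\<^sup>2) * exp (- (c / 2) * (norm z)\<^sup>2) * exp (- (\<beta> / 2) * (norm (y - z))\<^sup>2)"
proof -
  have "R\<^sup>2 \<le> (norm (y, z))\<^sup>2" using R by (intro power_mono) auto
  then have "R\<^sup>2 \<le> (norm y)\<^sup>2 + (norm z)\<^sup>2" by (simp add: norm_Pair)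
  then have 1: "c / 2 * R\<^sup>2 \<le> c / 2 * ((norm y)\<^sup>2 + (norm z)\<^sup>2)" using c by (intro mult_left_mono) auto
  have 2: "\<beta>\<^sub>0 * (norm (y - z))\<^sup>2 \<le> \<beta> / 2 * (norm (y - z))\<^sup>2"
    using \<beta> by (intro mult_right_mono) auto
  have 3: "0 \<le> c / 2 * (norm y)\<^sup>2" using c by simp
  have "- \<Phi> y + - \<beta> * (norm (y - z))\<^sup>2
      \<le> b - c / 2 * R\<^sup>2 + - (c / 2) * (norm z)\<^sup>2 + - (\<beta> / 2) * (norm (y - z))\<^sup>2"
    using 1 2 3 conf by (simp add: algebra_simps)
  then show ?thesis by (simp only: exp_add[symmetric] exp_le_cancel_iff)
qed

text \<open>
  The case \<open>R = 0\<close> gives the bound on the total mass, large \<open>R\<close> gives tightness.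
\<close>

lemma emeasure_thermalization_le:
  assumes \<beta>: "\<beta> \<ge> 2 * \<beta>\<^sub>0" and A: "A \<in> sets borel" and R: "0 \<le> R" "\<And>x. x \<in> A \<Longrightarrow> R \<le> norm x"
  shows "emeasure (thermalization \<mu> \<beta>) A \<le> ennreal (exp (b - c / 2 * R\<^sup>2) * sqrt 2 ^ DIM('a)) * gaussian_mass"
proof -
  define B where "B = (\<integral>\<xi>. exp (- \<beta> * (norm \<xi>)\<^sup>2) \<partial>(lborel :: 'a measure))"
  have \<beta>pos: "\<beta> > 0" using \<beta> \<beta>\<^sub>0 by simp
  have B: "B > 0" unfolding B_def by (rule gaussian_lborel(1)[OF \<beta>pos])
  let ?w = "\<lambda>(y, z). ennreal (thermal_weight \<beta> y z)"
  let ?a = "\<lambda>z. ennreal (exp (b - c / 2 * R\<^sup>2) * exp (- (c / 2) * (norm z)\<^sup>2))"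
  let ?g = "\<lambda>y z. ennreal (inverse B * exp (- (\<beta> / 2) * (norm (y - z))\<^sup>2))"
  have [measurable]: "?w \<in> borel_measurable \<mu>"
    using thermal_weight_measurable measurable_cong_sets[OF sets_\<mu> refl] by blast
  have "emeasure (thermalization \<mu> \<beta>) A = (\<integral>\<^sup>+x. ?w x * indicator A x \<partial>\<mu>)"
    unfolding thermalization_def using A by (intro emeasure_density) (auto simp: sets_\<mu>)
  also have "\<dots> = (\<integral>\<^sup>+z. \<integral>\<^sup>+y. ennreal (exp (- \<Phi> y)) * (?w (y, z) * indicator A (y, z)) \<partial>lborel \<partial>H)"
    using A by (intro nn_integral_\<mu> borel_measurable_times_ennreal thermal_weight_measurable
        borel_measurable_indicator)
  also have "\<dots> \<le> (\<integral>\<^sup>+z. \<integral>\<^sup>+y. ?a z * ?g y z \<partial>lborel \<partial>H)"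
  proof (rule nn_integral_mono_AE, use confinement in eventually_elim, rule nn_integral_mono)
    fix z y :: 'a
    assume conf: "\<forall>y. \<beta>\<^sub>0 * (norm (y - z))\<^sup>2 + \<Phi> y \<ge> c * ((norm y)\<^sup>2 + (norm z)\<^sup>2) - b"
    show "ennreal (exp (- \<Phi> y)) * (?w (y, z) * indicator A (y, z)) \<le> ?a z * ?g y z"
    proof (cases "(y, z) \<in> A")
      case True
      have "inverse B * (exp (- \<Phi> y) * exp (- \<beta> * (norm (y - z))\<^sup>2)) \<le> inverse B *
         (exp (b - c / 2 * R\<^sup>2) * exp (- (c / 2) * (norm z)\<^sup>2) * exp (- (\<beta> / 2) * (norm (y - z))\<^sup>2))"
        using B conf by (intro mult_left_mono weighted_density_le \<beta> R(1) R(2)[OF True]) auto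
      then have "ennreal (exp (- \<Phi> y) * (inverse B * exp (- \<beta> * (norm (y - z))\<^sup>2))) \<le>
         ennreal (exp (b - c / 2 * R\<^sup>2) * exp (- (c / 2) * (norm z)\<^sup>2)
           * (inverse B * exp (- (\<beta> / 2) * (norm (y - z))\<^sup>2)))"
        by (intro ennreal_leI) (simp only: mult_ac)
      then show ?thesis
        unfolding thermal_weight_def B_def[symmetric] using True B by (simp add: ennreal_mult)
    qed simp
  qed
  also have "\<dots> = (\<integral>\<^sup>+z. ?a z * ennreal (sqrt 2 ^ DIM('a)) \<partial>H)"
  proof (rule nn_integral_cong)
    fix z :: 'a
    have "(\<integral>\<^sup>+y. ?a z * ?g y z \<partial>lborel) = ?a z * (\<integral>\<^sup>+y. ?g y z \<partial>lborel)"
      by (rule nn_integral_cmult) measurable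
    also have "(\<integral>\<^sup>+y. ?g y z \<partial>lborel) = ennreal (sqrt 2 ^ DIM('a))"
      by (rule nn_integral_half_thermal_weight[OF \<beta>pos, of z, folded B_def])
    finally show "(\<integral>\<^sup>+y. ?a z * ?g y z \<partial>lborel) = ?a z * ennreal (sqrt 2 ^ DIM('a))" .
  qed
  also have "\<dots> = (\<integral>\<^sup>+z. ennreal (exp (b - c / 2 * R\<^sup>2) * sqrt 2 ^ DIM('a))
      * ennreal (exp (- (c / 2) * (norm z)\<^sup>2)) \<partial>H)"
    by (intro nn_integral_cong) (simp add: ennreal_mult mult_ac)
  also have "\<dots> = ennreal (exp (b - c / 2 * R\<^sup>2) * sqrt 2 ^ DIM('a)) * gaussian_mass"
    unfolding gaussian_mass_def by (intro nn_integral_cmult) measurable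
  finally show ?thesis .
qed

lemma sets_thermalization: "sets (thermalization \<mu> \<beta>) = sets borel"
  by (simp add: thermalization_def sets_\<mu>)

lemma space_thermalization: "space (thermalization \<mu> \<beta>) = UNIV"
  using sets_eq_imp_space_eq[OF sets_thermalization] by simp

definition mass_bound :: real where
  "mass_bound = exp b * sqrt 2 ^ DIM('a) * enn2real gaussian_mass"

lemma mass_bound_nonneg: "0 \<le> mass_bound" by (simp add: mass_bound_def)

lemma emeasure_thermalization_outside_le:
  assumes "\<beta> \<ge> 2 * \<beta>\<^sub>0" "A \<in> sets borel" "0 \<le> R" "\<And>x. x \<in> A \<Longrightarrow> R \<le> norm x"
  shows "emeasure (thermalization \<mu> \<beta>) A \<le> ennreal (mass_bound * exp (- (c / 2) * R\<^sup>2))"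
proof -
  have gaussian_mass: "gaussian_mass = ennreal (enn2real gaussian_mass)" using gaussian_mass_finite by simp
  have "emeasure (thermalization \<mu> \<beta>) A \<le> ennreal (exp (b - c / 2 * R\<^sup>2) * sqrt 2 ^ DIM('a)) * gaussian_mass"
    by (rule emeasure_thermalization_le[OF assms])
  also have "\<dots> = ennreal (exp (b - c / 2 * R\<^sup>2) * sqrt 2 ^ DIM('a) * enn2real gaussian_mass)"
    by (subst gaussian_mass) (rule ennreal_mult[symmetric], auto)
  also have "exp (b - c / 2 * R\<^sup>2) * sqrt 2 ^ DIM('a) * enn2real gaussian_mass = mass_bound * exp (- (c / 2) * R\<^sup>2)"
    using exp_add[of b "- (c / 2) * R\<^sup>2"] by (simp add: mass_bound_def)
  finally show ?thesis .
qed

lemma emeasure_thermalization_UNIV_le: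
  assumes "\<beta> \<ge> 2 * \<beta>\<^sub>0"
  shows "emeasure (thermalization \<mu> \<beta>) UNIV \<le> ennreal mass_bound"
  using emeasure_thermalization_outside_le[OF assms, of UNIV 0] by simp

lemma thermalization_finite_radon:
  assumes "\<beta> \<ge> 2 * \<beta>\<^sub>0"
  shows "thermalization \<mu> \<beta> \<in> finite_radon_measures"
proof -
  have U: "emeasure (thermalization \<mu> \<beta>) UNIV < \<infinity>"
    using emeasure_thermalization_UNIV_le[OF assms] by (auto simp: less_top[symmetric] top_unique)
  have "emeasure (thermalization \<mu> \<beta>) K < \<infinity>" for K
    using emeasure_space[of "thermalization \<mu> \<beta>" K] U by (simp add: space_thermalization)
  then show ?thesis
    by (simp add: finite_radon_measures_def radon_measures_def sets_thermalization)
qed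

text \<open>
  On a compact set a single thermal weight is bounded below by a positive constant, so \<open>\<mu>\<close> inherits local
  finiteness from its thermalization.
\<close>

lemma \<mu>_radon: "\<mu> \<in> radon_measures"
  unfolding radon_measures_def mem_Collect_eq
proof (intro conjI allI impI sets_\<mu>)
  fix K :: "('a \<times> 'a) set" assume K: "compact K"
  then have Kb: "K \<in> sets borel" by (intro borel_closed compact_imp_closed)
  obtain R where R: "R > 0" "\<And>x. x \<in> K \<Longrightarrow> norm x \<le> R"
    using compact_imp_bounded[OF K] by (auto simp: bounded_pos)
  define \<beta> where "\<beta> = 2 * \<beta>\<^sub>0"
  have \<beta>: "\<beta> \<ge> 2 * \<beta>\<^sub>0" "\<beta> > 0" using \<beta>\<^sub>0 by (auto simp: \<beta>_def)
  define B where "B = (\<integral>\<xi>. exp (- \<beta> * (norm \<xi>)\<^sup>2) \<partial>(lborel :: 'a measure))"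
  have B: "B > 0" unfolding B_def by (rule gaussian_lborel(1)[OF \<beta>(2)])
  define \<delta> where "\<delta> = inverse B * exp (- \<beta> * (2 * R)\<^sup>2)"
  have \<delta>: "\<delta> > 0" using B by (simp add: \<delta>_def)
  have w: "\<delta> \<le> thermal_weight \<beta> y z" if yz: "(y, z) \<in> K" for y z
  proof -
    have "norm (y - z) \<le> norm y + norm z" by (rule norm_triangle_ineq4)
    also have "\<dots> \<le> 2 * R"
      using R(2)[OF yz] norm_fst_le[of y z] norm_snd_le[where x = y and y = z] by simp
    finally have "(norm (y - z))\<^sup>2 \<le> (2 * R)\<^sup>2" by (intro power_mono) auto
    then show ?thesis
      unfolding \<delta>_def thermal_weight_def B_def[symmetric] using B \<beta>(2) by (intro mult_left_mono) auto
  qed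
  have wm: "(\<lambda>(y, z). ennreal (thermal_weight \<beta> y z)) \<in> borel_measurable \<mu>"
    using thermal_weight_measurable measurable_cong_sets[OF sets_\<mu> refl] by blast
  have "ennreal \<delta> * emeasure \<mu> K = (\<integral>\<^sup>+x. ennreal \<delta> * indicator K x \<partial>\<mu>)"
    using Kb by (subst nn_integral_cmult_indicator) (auto simp: sets_\<mu>)
  also have "\<dots> \<le> (\<integral>\<^sup>+x. (\<lambda>(y, z). ennreal (thermal_weight \<beta> y z)) x * indicator K x \<partial>\<mu>)"
    using w by (intro nn_integral_mono) (auto split: split_indicator intro!: ennreal_leI)
  also have "\<dots> = emeasure (thermalization \<mu> \<beta>) K"
    unfolding thermalization_def using Kb wm by (intro emeasure_density[symmetric]) (auto simp: sets_\<mu>)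
  also have "\<dots> \<le> emeasure (thermalization \<mu> \<beta>) UNIV"
    using emeasure_space[of "thermalization \<mu> \<beta>" K] by (simp add: space_thermalization)
  also have "\<dots> \<le> ennreal mass_bound"
    by (rule emeasure_thermalization_UNIV_le[OF \<beta>(1)])
  finally have "ennreal \<delta> * emeasure \<mu> K < \<infinity>" by (rule order.strict_trans1) simp
  then show "emeasure \<mu> K < \<infinity>"
    using \<delta> by (auto simp: ennreal_mult_less_top)
qed

lemma thermalizations_uniformly_bounded:
  "uniformly_bounded_measures {measure (thermalization \<mu> \<beta>) | \<beta>. \<beta> \<ge> 2 * \<beta>\<^sub>0}"
  unfolding uniformly_bounded_measures_def
proof (intro exI[of _ "mass_bound + 1"] conjI ballI)
  show "mass_bound + 1 > 0" using mass_bound_nonneg by linarith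
  fix \<nu> assume "\<nu> \<in> {measure (thermalization \<mu> \<beta>) | \<beta>. \<beta> \<ge> 2 * \<beta>\<^sub>0}"
  then obtain \<beta> where \<nu>: "\<nu> = measure (thermalization \<mu> \<beta>)" and \<beta>: "\<beta> \<ge> 2 * \<beta>\<^sub>0" by blast
  have "total_variation \<nu> UNIV = emeasure (thermalization \<mu> \<beta>) UNIV"
    unfolding \<nu> by (intro total_variation_measure thermalization_finite_radon \<beta>) simp
  also have "\<dots> \<le> ennreal mass_bound" by (rule emeasure_thermalization_UNIV_le[OF \<beta>])
  also have "\<dots> < ennreal (mass_bound + 1)" using mass_bound_nonneg by (intro ennreal_lessI) auto
  finally show "total_variation \<nu> UNIV < ennreal (mass_bound + 1)" .
qed

lemma thermalization_tail:
  assumes \<epsilon>: "\<epsilon> > 0"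
  obtains R where "\<And>\<beta>. \<beta> \<ge> 2 * \<beta>\<^sub>0 \<Longrightarrow> emeasure (thermalization \<mu> \<beta>) (UNIV - cball 0 R) < ennreal \<epsilon>"
proof -
  have "((\<lambda>R. mass_bound * exp (- (c / 2) * R\<^sup>2)) \<longlongrightarrow> mass_bound * 0) at_top"
  proof (intro tendsto_intros filterlim_compose[OF exp_at_bot])
    have "filterlim (\<lambda>R::real. (c / 2) * R\<^sup>2) at_top at_top"
      using c by (intro filterlim_tendsto_pos_mult_at_top[OF tendsto_const] filterlim_pow_at_top
          filterlim_ident) auto
    then show "filterlim (\<lambda>R::real. - (c / 2) * R\<^sup>2) at_bot at_top"
      by (simp add: filterlim_uminus_at_top)
  qed
  then have "\<forall>\<^sub>F R in at_top. mass_bound * exp (- (c / 2) * R\<^sup>2) < \<epsilon>"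
    using order_tendstoD(2)[of _ "mass_bound * 0" at_top \<epsilon>] \<epsilon> by simp
  then have "\<forall>\<^sub>F R in at_top. 0 \<le> R \<and> mass_bound * exp (- (c / 2) * R\<^sup>2) < \<epsilon>"
    using eventually_ge_at_top[of 0] by eventually_elim simp
  then obtain R where R: "0 \<le> R" "mass_bound * exp (- (c / 2) * R\<^sup>2) < \<epsilon>"
    by (auto dest: eventually_happens)
  have "emeasure (thermalization \<mu> \<beta>) (UNIV - cball 0 R) < ennreal \<epsilon>" if "\<beta> \<ge> 2 * \<beta>\<^sub>0" for \<beta>
  proof -
    have "emeasure (thermalization \<mu> \<beta>) (UNIV - cball 0 R) \<le> ennreal (mass_bound * exp (- (c / 2) * R\<^sup>2))"
      by (intro emeasure_thermalization_outside_le[OF that]) (auto simp: R(1))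
    also have "\<dots> < ennreal \<epsilon>" using R(2) \<epsilon> by (intro ennreal_lessI) auto
    finally show ?thesis .
  qed
  then show thesis by (rule that)
qed

lemma thermalizations_uniformly_tight:
  "uniformly_tight_measures {measure (thermalization \<mu> \<beta>) | \<beta>. \<beta> \<ge> 2 * \<beta>\<^sub>0}"
  unfolding uniformly_tight_measures_def
proof (intro allI impI)
  fix \<epsilon> :: real assume "\<epsilon> > 0"
  then obtain R where R:
    "\<And>\<beta>. \<beta> \<ge> 2 * \<beta>\<^sub>0 \<Longrightarrow> emeasure (thermalization \<mu> \<beta>) (UNIV - cball 0 R) < ennreal \<epsilon>"
    by (rule thermalization_tail) blast
  have "total_variation (measure (thermalization \<mu> \<beta>)) (UNIV - cball 0 R) < ennreal \<epsilon>"
    if "\<beta> \<ge> 2 * \<beta>\<^sub>0" for \<beta>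
    using R[OF that] by (subst total_variation_measure[OF thermalization_finite_radon[OF that]]) auto
  then show "\<exists>K. compact K \<and> (\<forall>\<nu>\<in>{measure (thermalization \<mu> \<beta>) | \<beta>. \<beta> \<ge> 2 * \<beta>\<^sub>0}.
      total_variation \<nu> (UNIV - K) < ennreal \<epsilon>)"
    by (intro exI[of _ "cball 0 R"]) auto
qed

lemma ex_diagonal_concentration: "\<exists>\<mu>'. diagonal_concentration \<mu> \<mu>'"
proof -
  define \<beta> where "\<beta> n = 2 * \<beta>\<^sub>0 + real n" for n
  have \<beta>: "\<beta> n \<ge> 2 * \<beta>\<^sub>0" "\<beta> n > 0" for n using \<beta>\<^sub>0 by (auto simp: \<beta>_def)
  have lim: "filterlim \<beta> at_top sequentially"
    unfolding \<beta>_def by (intro filterlim_tendsto_add_at_top[OF tendsto_const] filterlim_real_sequentially)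
  have tight: "\<exists>R. \<forall>n. emeasure (thermalization \<mu> (\<beta> n)) (UNIV - cball 0 R) \<le> ennreal \<epsilon>"
    if "\<epsilon> > 0" for \<epsilon>
    using thermalization_tail[OF that] \<beta>(1) by (metis less_imp_le)
  obtain r \<mu>' where r: "strict_mono (r :: nat \<Rightarrow> nat)" and \<mu>': "finite_measure \<mu>'" "sets \<mu>' = sets borel"
    and conv: "\<And>f :: 'a \<times> 'a \<Rightarrow> real. continuous_on UNIV f \<Longrightarrow> bounded (range f) \<Longrightarrow>
       (\<lambda>n. \<integral>x. f x \<partial>thermalization \<mu> (\<beta> (r n))) \<longlonglongrightarrow> (\<integral>x. f x \<partial>\<mu>')"
    using tight_finite_measures_narrow_subsequence[OF sets_thermalization
        emeasure_thermalization_UNIV_le[OF \<beta>(1)] tight] by metis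
  have fr: "\<mu>' \<in> finite_radon_measures"
    using finite_measure.emeasure_finite[OF \<mu>'(1)]
    by (auto simp: finite_radon_measures_def radon_measures_def \<mu>'(2) less_top)
  have "narrow_convergence (\<lambda>n. measure (thermalization \<mu> (\<beta> (r n)))) (measure \<mu>')"
    unfolding narrow_convergence_def using conv
    by (auto simp: real_measure_integral_measure[OF thermalization_finite_radon[OF \<beta>(1)]]
        real_measure_integral_measure[OF fr])
  then have "diagonal_concentration \<mu> \<mu>'"
    unfolding diagonal_concentration_def
    using \<mu>_radon fr \<beta> filterlim_compose[OF lim filterlim_subseq[OF r]] thermalization_finite_radon
    by (intro conjI exI[of _ "\<lambda>n. \<beta> (r n)"]) auto
  then show ?thesis ..
qed

end

theorem proposition3p3:
  fixes E :: "'a::euclidean_space set" and \<Phi> :: "'a \<Rightarrow> real"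
    and N :: nat and \<beta>\<^sub>0 c b :: real
    and \<mu> :: "('a \<times> 'a) measure"
    and M :: "(('a \<times> 'a) set \<Rightarrow> real) set"
  assumes dim_Z: "DIM('a) = 2 * N"
    and E: "affine E" "aff_dim E = int N"
    and \<Phi>: "\<Phi> \<in> borel_measurable borel"
    and \<mu>_def: "\<mu> = density lborel (\<lambda>y. ennreal (exp (- \<Phi> y)))
                   \<Otimes>\<^sub>M density (hausdorff_measure N) (indicator E)"
    and const_pos: "\<beta>\<^sub>0 > 0" "c > 0" "b > 0"
    and bound: "\<forall>y. \<forall>z\<in>E. \<beta>\<^sub>0 * (norm (y - z))\<^sup>2 + \<Phi> y \<ge> c * ((norm y)\<^sup>2 + (norm z)\<^sup>2) - b"
    and M_def: "M = {measure (thermalization \<mu> \<beta>) | \<beta>. \<beta> \<ge> 2 * \<beta>\<^sub>0}"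
  shows "(\<forall>\<beta> \<ge> 2 * \<beta>\<^sub>0. thermalization \<mu> \<beta> \<in> finite_radon_measures)
    \<and> M \<subseteq> real_radon_measures
    \<and> uniformly_bounded_measures M
    \<and> uniformly_tight_measures M
    \<and> weakly_transversal \<mu>
    \<and> (\<exists>\<mu>'. diagonal_concentration \<mu> \<mu>')"
proof -
  let ?H = "density (hausdorff_measure N) (indicator E) :: 'a measure"
  obtain C where C: "\<And>R. 1 \<le> R \<Longrightarrow> emeasure ?H (cball 0 R) \<le> ennreal (C * R ^ N)"
    by (rule hausdorff_measure_affine_growth[OF E]) blast
  have "E \<in> sets borel" using affine_closed[OF E(1)] by (rule borel_closed)
  then have "AE z in ?H. z \<in> E"
    by (subst AE_density) (auto split: split_indicator)
  then have AE: "AE z in ?H. \<forall>y. \<beta>\<^sub>0 * (norm (y - z))\<^sup>2 + \<Phi> y \<ge> c * ((norm y)\<^sup>2 + (norm z)\<^sup>2) - b"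
    by eventually_elim (use bound in blast)
  interpret G: gaussian_confinement \<Phi> ?H \<beta>\<^sub>0 c b C N
    using \<Phi> C const_pos AE by unfold_locales auto
  have \<mu>: "\<mu> = G.\<mu>" unfolding \<mu>_def G.\<mu>_def ..
  have fin: "\<forall>\<beta> \<ge> 2 * \<beta>\<^sub>0. thermalization \<mu> \<beta> \<in> finite_radon_measures"
    unfolding \<mu> using G.thermalization_finite_radon by blast
  then have "M \<subseteq> real_radon_measures"
    unfolding M_def by (auto intro: measure_in_real_radon_measures)
  then show ?thesis
    using fin G.thermalizations_uniformly_bounded G.thermalizations_uniformly_tight
      G.ex_diagonal_concentration
    unfolding M_def weakly_transversal_def \<mu> by blast
qed

end
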